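(* Let $U=(U_y)_{y\in\mathbb{Z}}$ and $V=(V_x)_{x\in\mathbb{Z}}$ be families of random variables with values in $\{-1,1\}$, all independent, each equal to $+1$ or $-1$ with probability $1/2$. Define $Z=(Z_n)_{n\ge 0}=((X_n,Y_n))_{n\ge 0}$ in $\mathbb{Z}^2$ by $Z_0=(0,0)$ and $Z_{n+1}=Z_n+(U_{Y_n},V_{X_n})$ for all $n\ge 0$. Then there exist positive constants $c_1,C_1,c_2,C_2$ such that, for all $n\in\mathbb{N}$, $$C_1 e^{-c_1 n^{1/3}}\le \mathbb{P}\Big(\max_{i\ge0}\|Z_i\|>n\Big)\le C_2 e^{-c_2 n^{1/4}}.$$
   Context: $\|\cdot\|$ is the Euclidean norm on $\mathbb{R}^2$. *)

theory Defs
  imports "HOL-Probability.Probability"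
begin

text \<open>The sign of row \<open>y\<close> is \<open>u y\<close> and the sign of column \<open>x\<close> is \<open>v x\<close>.\<close>

primrec walk :: "(int \<Rightarrow> int) \<Rightarrow> (int \<Rightarrow> int) \<Rightarrow> nat \<Rightarrow> int \<times> int" where
  "walk u v 0 = (0, 0)"
| "walk u v (Suc n) = walk u v n + (u (snd (walk u v n)), v (fst (walk u v n)))"

text \<open>The norm of the product space \<open>real \<times> real\<close> is the Euclidean one.\<close>

definition eucl_norm :: "int \<times> int \<Rightarrow> real" where
  "eucl_norm z = norm (real_of_int (fst z), real_of_int (snd z))"

text \<open>The supremum is taken in the extended reals because the orbit may be unbounded; when the
  orbit is bounded it takes finitely many values, so the supremum is the maximum.\<close>

definition max_norm :: "(int \<Rightarrow> int) \<Rightarrow> (int \<Rightarrow> int) \<Rightarrow> ereal" where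
  "max_norm u v = (SUP i. ereal (eucl_norm (walk u v i)))"

end

theory Submission
  imports Defs
begin

text \<open>
  \<^bold>\<open>Lower bound.\<close> If every column \<open>x\<close> with \<open>\<bar>x\<bar> \<le> L\<close> has sign \<open>1\<close>, the walk climbs one row per step
  and its abscissa is the partial sum of the row signs met so far, as long as that sum stays in
  \<open>[-L, L]\<close>. The columns cost a factor \<open>2 ^ - (2 * L + 1)\<close>, and a simple random walk stays in
  \<open>[-L, L]\<close> for \<open>n\<close> steps with probability at least \<open>exp (- 4 * n / L\<^sup>2)\<close>. The two costs balance
  for \<open>L\<close> of order \<open>n\<close> to the power \<open>1 / 3\<close>.

  \<^bold>\<open>Upper bound.\<close> Let \<open>r\<close> be of order \<open>n\<close> to the power \<open>1 / 4\<close> and \<open>m = r ^ 4 + 1\<close>. A walk that gets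
  farther than \<open>n\<close> leaves the box \<open>[-m, m] \<times> [-m, m]\<close>, by symmetry through its right side. Let it
  enter a column \<open>x > 0\<close> for the first time, in row \<open>y\<close>. The sign of the column \<open>x\<close> has had no
  influence so far. If the row \<open>y\<close> has sign \<open>-1\<close>, the next step leads back to the column \<open>x - 1\<close>;
  if moreover the columns \<open>x\<close> and \<open>x - 1\<close> have opposite signs, it leads back to the point that the
  walk has just left, and the walk oscillates between two points forever. So such a column is a test
  that is passed with conditional probability \<open>1 / 2\<close>, and passing \<open>r\<close> tests has probability at most
  \<open>2 ^ - r\<close> (\<open>test_passed\<close>, \<open>repeated_tests\<close>).

  If there are fewer than \<open>r\<close> tests in the columns \<open>1, \<dots>, r ^ 4\<close>, some \<open>r ^ 3\<close> consecutive columns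
  contain none. The walk crosses them moving to the right at every step, its height is a
  simple random walk driven by the signs of these columns, and all rows that it visits have sign
  \<open>1\<close> (\<open>untested_block\<close>). Either there are \<open>r\<close> consecutive rows of sign \<open>1\<close> in the box, which has
  probability at most \<open>(2 * m + 1) * 2 ^ - r\<close>, or a random walk stays in \<open>[-r, r]\<close> for \<open>r ^ 3\<close>
  steps, which has probability at most \<open>2 * exp (- r / 16)\<close> for each of \<open>r\<close> possible blocks.

  Both estimates for confined random walks come from the eigenfunction \<open>x \<mapsto> cos (\<theta> * x)\<close> of the
  random walk, whose eigenvalue is \<open>cos \<theta>\<close>.
\<close>

section \<open>Finitely many fair coins\<close>

text \<open>The events to be estimated reduce to events that depend on finitely many signs, whose
  probabilities are relative frequencies among the configurations of a finite set of
  coins. The coins outside this set are put to \<open>1\<close> so that a configuration consists of signs everywhere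
  and still drives a walk with unit steps.\<close>
definition configs :: "'i set \<Rightarrow> ('i \<Rightarrow> int) set" where
  "configs J = PiE_dflt J 1 (\<lambda>_. {-1, 1})"

definition coin_prob :: "'i set \<Rightarrow> (('i \<Rightarrow> int) \<Rightarrow> bool) \<Rightarrow> real" where
  "coin_prob J Q = real (card {f \<in> configs J. Q f}) / 2 ^ card J"

definition flip :: "'i \<Rightarrow> ('i \<Rightarrow> int) \<Rightarrow> 'i \<Rightarrow> int" where
  "flip i f = f(i := - f i)"

lemma flip_apply: "flip i f j = (if j = i then - f j else f j)"
  by (simp add: flip_def)

lemma flip_flip [simp]: "flip i (flip i f) = f"
  by (simp add: fun_eq_iff flip_apply)

lemma configs_sign: "f \<in> configs J \<Longrightarrow> f i \<in> {-1, 1}"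
  by (cases "i \<in> J") (auto simp: configs_def PiE_dflt_def)

lemma configs_cases: "f \<in> configs J \<Longrightarrow> f i = -1 \<or> f i = 1"
  using configs_sign[of f J i] by simp

lemma finite_configs: "finite J \<Longrightarrow> finite (configs J)"
  unfolding configs_def by (intro finite_PiE_dflt) auto

lemma card_configs: "finite J \<Longrightarrow> card (configs J) = 2 ^ card J"
  unfolding configs_def by (subst card_PiE_dflt) (auto simp: numeral_2_eq_2)

lemma flip_configs: "i \<in> J \<Longrightarrow> f \<in> configs J \<Longrightarrow> flip i f \<in> configs J"
  unfolding configs_def PiE_dflt_def flip_def by auto

lemma coin_prob_nonneg: "0 \<le> coin_prob J Q"
  by (simp add: coin_prob_def)

lemma coin_prob_True: "finite J \<Longrightarrow> coin_prob J (\<lambda>_. True) = 1"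
  by (simp add: coin_prob_def card_configs)

lemma coin_prob_False: "coin_prob J (\<lambda>_. False) = 0"
  by (simp add: coin_prob_def)

lemma coin_prob_cong:
  "(\<And>f. f \<in> configs J \<Longrightarrow> P f = Q f) \<Longrightarrow> coin_prob J P = coin_prob J Q"
  unfolding coin_prob_def by (auto intro!: arg_cong[where f = card])

lemma coin_prob_mono:
  assumes "finite J" "\<And>f. f \<in> configs J \<Longrightarrow> P f \<Longrightarrow> Q f"
  shows "coin_prob J P \<le> coin_prob J Q"
  unfolding coin_prob_def using assms finite_configs[of J]
  by (intro divide_right_mono of_nat_mono card_mono) auto

lemma coin_prob_disj:
  assumes "finite J"
  shows "coin_prob J (\<lambda>f. P f \<or> Q f) \<le> coin_prob J P + coin_prob J Q"
proof -
  have "{f \<in> configs J. P f \<or> Q f} = {f \<in> configs J. P f} \<union> {f \<in> configs J. Q f}" by auto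
  then have "card {f \<in> configs J. P f \<or> Q f} \<le> card {f \<in> configs J. P f} + card {f \<in> configs J. Q f}"
    by (simp add: card_Un_le)
  then show ?thesis
    unfolding coin_prob_def add_divide_distrib[symmetric] of_nat_add[symmetric]
    by (intro divide_right_mono of_nat_mono) auto
qed

lemma coin_prob_split:
  assumes "finite J"
  shows "coin_prob J Q = coin_prob J (\<lambda>f. Q f \<and> R f) + coin_prob J (\<lambda>f. Q f \<and> \<not> R f)"
proof -
  have "{f \<in> configs J. Q f} = {f \<in> configs J. Q f \<and> R f} \<union> {f \<in> configs J. Q f \<and> \<not> R f}" by auto
  then have "card {f \<in> configs J. Q f} =
      card {f \<in> configs J. Q f \<and> R f} + card {f \<in> configs J. Q f \<and> \<not> R f}"
    using finite_configs[OF assms] by (subst card_Un_disjoint[symmetric]) auto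
  then show ?thesis by (simp add: coin_prob_def add_divide_distrib)
qed

lemma coin_prob_Ex:
  assumes "finite J" "finite B" "\<And>b. b \<in> B \<Longrightarrow> coin_prob J (P b) \<le> p"
  shows "coin_prob J (\<lambda>f. \<exists>b\<in>B. P b f) \<le> real (card B) * p"
  using assms(2,3)
proof (induction B rule: finite_induct)
  case empty
  then show ?case by (simp add: coin_prob_False)
next
  case (insert b B)
  have "coin_prob J (\<lambda>f. \<exists>b\<in>insert b B. P b f) = coin_prob J (\<lambda>f. P b f \<or> (\<exists>b\<in>B. P b f))"
    by (intro coin_prob_cong) auto
  also have "\<dots> \<le> coin_prob J (P b) + coin_prob J (\<lambda>f. \<exists>b\<in>B. P b f)"
    by (rule coin_prob_disj[OF assms(1)])
  also have "\<dots> \<le> p + real (card B) * p"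
    using insert by (intro add_mono) auto
  finally show ?case using insert by (simp add: algebra_simps)
qed

text \<open>Flipping the coin \<open>i\<close> exchanges the configurations that agree with the prediction \<open>s\<close> and
  those that do not. Independence of the coin \<open>i\<close> is expressed as invariance under this flip, which
  avoids naming the coins on which \<open>Q\<close> and \<open>s\<close> do depend.\<close>
lemma coin_prob_fresh:
  assumes "finite J" "i \<in> J"
    and Q: "\<And>f. Q (flip i f) = Q f" and s: "\<And>f. s (flip i f) = s f"
    and s1: "\<And>f. f \<in> configs J \<Longrightarrow> s f \<in> {-1, 1}"
  shows "coin_prob J (\<lambda>f. Q f \<and> f i = s f) = coin_prob J Q / 2"
proof -
  have "bij_betw (flip i) {f \<in> configs J. Q f \<and> f i = s f} {f \<in> configs J. Q f \<and> \<not> f i = s f}"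
  proof (rule bij_betw_byWitness[where f' = "flip i"])
    show "flip i ` {f \<in> configs J. Q f \<and> f i = s f} \<subseteq> {f \<in> configs J. Q f \<and> \<not> f i = s f}"
    proof safe
      fix f assume f: "f \<in> configs J" "Q f" "f i = s f"
      show "flip i f \<in> configs J" using f flip_configs[OF assms(2)] by blast
      show "Q (flip i f)" using f Q by blast
      show False if "flip i f i = s (flip i f)"
        using that f s s1[of f] by (auto simp: flip_apply)
    qed
    show "flip i ` {f \<in> configs J. Q f \<and> \<not> f i = s f} \<subseteq> {f \<in> configs J. Q f \<and> f i = s f}"
    proof safe
      fix f assume f: "f \<in> configs J" "Q f" "f i \<noteq> s f"
      show "flip i f \<in> configs J" using f flip_configs[OF assms(2)] by blast
      show "Q (flip i f)" using f Q by blast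
      show "flip i f i = s (flip i f)"
        using f s s1[of f] configs_cases[OF f(1), of i] by (auto simp: flip_apply)
    qed
  qed simp_all
  then have "coin_prob J (\<lambda>f. Q f \<and> f i = s f) = coin_prob J (\<lambda>f. Q f \<and> \<not> f i = s f)"
    by (simp add: coin_prob_def bij_betw_same_card)
  with coin_prob_split[OF assms(1), of Q "\<lambda>f. f i = s f"] show ?thesis by simp
qed

lemma coin_prob_all_one:
  assumes "finite J" "I \<subseteq> J"
  shows "coin_prob J (\<lambda>f. \<forall>i\<in>I. f i = 1) = (1 / 2) ^ card I"
proof -
  have "finite I" using assms finite_subset by blast
  then show ?thesis using assms(2)
  proof (induction I rule: finite_induct)
    case empty
    then show ?case by (simp add: coin_prob_True assms)
  next
    case (insert i I)
    have "coin_prob J (\<lambda>f. \<forall>i\<in>insert i I. f i = 1) = coin_prob J (\<lambda>f. (\<forall>i\<in>I. f i = 1) \<and> f i = 1)"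
      by (intro coin_prob_cong) auto
    also have "\<dots> = coin_prob J (\<lambda>f. \<forall>i\<in>I. f i = 1) / 2"
    proof (rule coin_prob_fresh[OF assms(1)])
      show "(\<forall>k\<in>I. flip i f k = 1) = (\<forall>k\<in>I. f k = 1)" for f :: "'a \<Rightarrow> int"
        using insert(2) by (metis flip_apply)
    qed (use insert in auto)
    finally show ?case using insert by simp
  qed
qed

section \<open>Repeated tests against fresh coins\<close>

text \<open>The coins \<open>c 0, c 1, \<dots>\<close> are revealed in this order. Whether there is a test at time \<open>j\<close>, and
  the outcome \<open>s j\<close> that passes it, are decided before the coin \<open>c j\<close> is tossed; so every test
  halves the probability of survival. The event \<open>Q\<close> about the past is arbitrary because the
  induction runs backwards in time and conditions on what happens at time \<open>a\<close>: a
  test at time \<open>a\<close> is charged to \<open>Q\<close>, and the later tests to the induction hypothesis.\<close>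
lemma repeated_tests:
  fixes c :: "nat \<Rightarrow> 'i" and test :: "nat \<Rightarrow> ('i \<Rightarrow> int) \<Rightarrow> bool" and s :: "nat \<Rightarrow> ('i \<Rightarrow> int) \<Rightarrow> int"
  assumes J: "finite J" and cJ: "\<And>j. j < N \<Longrightarrow> c j \<in> J" and inj: "inj c"
    and test: "\<And>j k f. j \<le> k \<Longrightarrow> test j (flip (c k) f) = test j f"
    and s: "\<And>j k f. j \<le> k \<Longrightarrow> s j (flip (c k) f) = s j f"
    and s1: "\<And>j f. f \<in> configs J \<Longrightarrow> s j f \<in> {-1, 1}"
    and survive: "\<And>j f. \<lbrakk>f \<in> configs J; survive f; j < N; test j f\<rbrakk> \<Longrightarrow> f (c j) = s j f"
    and "a \<le> N"
    and Q: "\<And>k f. a \<le> k \<Longrightarrow> Q (flip (c k) f) = Q f"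
  shows "coin_prob J (\<lambda>f. Q f \<and> survive f \<and> k \<le> card {j \<in> {a..<N}. test j f}) \<le> coin_prob J Q / 2 ^ k"
  using \<open>a \<le> N\<close> Q
proof (induction a arbitrary: Q k rule: inc_induct)
  case base
  show ?case
  proof (cases k)
    case 0
    then show ?thesis by (auto intro: coin_prob_mono[OF J])
  next
    case (Suc k')
    then show ?thesis by (simp add: coin_prob_False coin_prob_nonneg)
  qed
next
  case (step a)
  define T where "T b f = {j \<in> {b..<N}. test j f}" for b f
  have T: "T a f = (if test a f then insert a (T (Suc a) f) else T (Suc a) f)" for f
    using step.hyps unfolding T_def by (auto simp: not_less_eq_eq le_less Suc_le_eq)
  have fT: "finite (T (Suc a) f)" "a \<notin> T (Suc a) f" for f by (auto simp: T_def)
  have cne: "c k \<noteq> c a" if "Suc a \<le> k" for k using inj that by (auto dest: injD)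
  have "coin_prob J (\<lambda>f. (Q f \<and> survive f \<and> k \<le> card (T a f)) \<and> \<not> test a f)
      \<le> coin_prob J (\<lambda>f. (Q f \<and> \<not> test a f) \<and> survive f \<and> k \<le> card (T (Suc a) f))"
    by (intro coin_prob_mono[OF J]) (auto simp: T)
  also have "\<dots> \<le> coin_prob J (\<lambda>f. Q f \<and> \<not> test a f) / 2 ^ k"
    unfolding T_def by (rule step.IH) (simp add: test step.prems)
  finally have 1: "coin_prob J (\<lambda>f. (Q f \<and> survive f \<and> k \<le> card (T a f)) \<and> \<not> test a f)
      \<le> coin_prob J (\<lambda>f. Q f \<and> \<not> test a f) / 2 ^ k" .
  have "coin_prob J (\<lambda>f. (Q f \<and> survive f \<and> k \<le> card (T a f)) \<and> test a f)
      \<le> coin_prob J (\<lambda>f. ((Q f \<and> test a f) \<and> f (c a) = s a f) \<and> survive f \<and> k - 1 \<le> card (T (Suc a) f))"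
    using survive step.hyps fT by (intro coin_prob_mono[OF J]) (auto simp: T)
  also have "\<dots> \<le> coin_prob J (\<lambda>f. (Q f \<and> test a f) \<and> f (c a) = s a f) / 2 ^ (k - 1)"
    unfolding T_def
  proof (rule step.IH)
    fix k :: nat and f :: "'i \<Rightarrow> int"
    assume k: "Suc a \<le> k"
    then show "((Q (flip (c k) f) \<and> test a (flip (c k) f)) \<and> flip (c k) f (c a) = s a (flip (c k) f)) =
       ((Q f \<and> test a f) \<and> f (c a) = s a f)"
      using test[of a k f] s[of a k f] step.prems[of k f] cne[OF k]
        flip_apply[of "c k" f "c a"]
      by simp
  qed
  also have "coin_prob J (\<lambda>f. (Q f \<and> test a f) \<and> f (c a) = s a f) = coin_prob J (\<lambda>f. Q f \<and> test a f) / 2"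
    by (rule coin_prob_fresh[OF J]) (use cJ step test s s1 in auto)
  also have "coin_prob J (\<lambda>f. Q f \<and> test a f) / 2 / 2 ^ (k - 1) \<le> coin_prob J (\<lambda>f. Q f \<and> test a f) / 2 ^ k"
    by (cases k) (auto simp: coin_prob_nonneg)
  finally have 2: "coin_prob J (\<lambda>f. (Q f \<and> survive f \<and> k \<le> card (T a f)) \<and> test a f)
      \<le> coin_prob J (\<lambda>f. Q f \<and> test a f) / 2 ^ k" .
  have "coin_prob J (\<lambda>f. Q f \<and> survive f \<and> k \<le> card (T a f)) \<le> coin_prob J Q / 2 ^ k"
    unfolding coin_prob_split[OF J, of Q "test a"]
      coin_prob_split[OF J, of "\<lambda>f. Q f \<and> survive f \<and> k \<le> card (T a f)" "test a"] add_divide_distrib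
    using 1 2 by linarith
  then show ?case unfolding T_def .
qed

section \<open>Random walks confined to an interval\<close>

text \<open>The probability that a simple random walk started at \<open>x\<close> stays in \<open>[-r, r]\<close> for \<open>n\<close> steps,
  computed by conditioning on the first step.\<close>
primrec stay_prob :: "nat \<Rightarrow> nat \<Rightarrow> int \<Rightarrow> real" where
  "stay_prob r 0 x = of_bool (\<bar>x\<bar> \<le> int r)"
| "stay_prob r (Suc n) x =
    of_bool (\<bar>x\<bar> \<le> int r) * (stay_prob r n (x + 1) + stay_prob r n (x - 1)) / 2"

lemma stay_prob_outside: "int r < \<bar>x\<bar> \<Longrightarrow> stay_prob r n x = 0"
  by (cases n) auto

text \<open>The factor \<open>coin_prob J Q\<close> is carried along because the induction step adds the outcome of the
  first coin to \<open>Q\<close>.\<close>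
lemma coin_prob_confined:
  assumes J: "finite J" and "\<And>i. i < n \<Longrightarrow> c i \<in> J" and "inj c"
    and "\<And>i f. Q (flip (c i) f) = Q f"
  shows "coin_prob J (\<lambda>f. Q f \<and> (\<forall>k\<le>n. \<bar>x + (\<Sum>i<k. f (c i))\<bar> \<le> int r)) =
    coin_prob J Q * stay_prob r n x"
  using assms(2-)
proof (induction n arbitrary: x c Q)
  case 0
  have "(\<forall>k\<le>0. \<bar>x + (\<Sum>i<k. f (c i))\<bar> \<le> int r) \<longleftrightarrow> \<bar>x\<bar> \<le> int r" for f by simp
  then show ?case by (simp add: coin_prob_False)
next
  case (Suc n)
  define conf where "conf x f \<longleftrightarrow> (\<forall>k\<le>n. \<bar>x + (\<Sum>i<k. f (c (Suc i)))\<bar> \<le> int r)" for x f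
  have shift: "(\<forall>k\<le>Suc n. \<bar>x + (\<Sum>i<k. f (c i))\<bar> \<le> int r) \<longleftrightarrow> \<bar>x\<bar> \<le> int r \<and> conf (x + f (c 0)) f" for f
  proof -
    have "(\<forall>k\<le>Suc n. P k) \<longleftrightarrow> P 0 \<and> (\<forall>k\<le>n. P (Suc k))" for P :: "nat \<Rightarrow> bool"
      by (metis Suc_le_mono le0 not0_implies_Suc)
    from this[of "\<lambda>k. \<bar>x + (\<Sum>i<k. f (c i))\<bar> \<le> int r"] show ?thesis
      by (simp only: conf_def sum.lessThan_Suc_shift) (simp add: add.assoc)
  qed
  have IH: "coin_prob J (\<lambda>f. (Q f \<and> f (c 0) = s) \<and> conf y f) = coin_prob J Q / 2 * stay_prob r n y"
    if "s \<in> {-1, 1}" for s y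
  proof -
    have "coin_prob J (\<lambda>f. (Q f \<and> f (c 0) = s) \<and> conf y f) =
        coin_prob J (\<lambda>f. Q f \<and> f (c 0) = s) * stay_prob r n y"
      unfolding conf_def
    proof (rule Suc.IH)
      show "inj (\<lambda>i. c (Suc i))" using \<open>inj c\<close> by (auto simp: inj_on_def)
      fix i f
      have "flip (c (Suc i)) f (c 0) = f (c 0)"
        using injD[OF \<open>inj c\<close>, of 0 "Suc i"] by (auto simp: flip_apply)
      then show "(Q (flip (c (Suc i)) f) \<and> flip (c (Suc i)) f (c 0) = s) = (Q f \<and> f (c 0) = s)"
        using Suc.prems(3)[of "Suc i" f] by simp
    qed (use Suc.prems in auto)
    also have "coin_prob J (\<lambda>f. Q f \<and> f (c 0) = s) = coin_prob J Q / 2"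
      by (rule coin_prob_fresh[OF J, where s = "\<lambda>_. s"]) (use Suc.prems that in auto)
    finally show ?thesis .
  qed
  show ?case
  proof (cases "\<bar>x\<bar> \<le> int r")
    case True
    have "coin_prob J (\<lambda>f. Q f \<and> (\<forall>k\<le>Suc n. \<bar>x + (\<Sum>i<k. f (c i))\<bar> \<le> int r)) =
        coin_prob J (\<lambda>f. (Q f \<and> f (c 0) = 1) \<and> conf (x + 1) f) +
        coin_prob J (\<lambda>f. (Q f \<and> f (c 0) = -1) \<and> conf (x - 1) f)"
      unfolding shift
      by (subst coin_prob_split[OF J, of _ "\<lambda>f. f (c 0) = 1"], rule arg_cong2[where f = "(+)"];
          rule coin_prob_cong) (use True configs_cases[of _ J "c 0"] in fastforce)+
    also have "\<dots> = coin_prob J Q / 2 * stay_prob r n (x + 1) + coin_prob J Q / 2 * stay_prob r n (x - 1)"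
      by (simp only: IH insertI1 insertI2)
    finally show ?thesis using True by (simp add: distrib_left add_divide_distrib)
  next
    case False
    then show ?thesis unfolding shift by (simp add: coin_prob_False)
  qed
qed

text \<open>The cosine is an eigenfunction of averaging over the two neighbours. The power of the eigenvalue
  is included because both bounds on \<open>stay_prob\<close> compare it with the recursion step by step.\<close>
lemma cos_eigenfunction:
  "cos \<theta> ^ Suc n * cos (\<theta> * of_int x) =
    (cos \<theta> ^ n * cos (\<theta> * of_int (x + 1)) + cos \<theta> ^ n * cos (\<theta> * of_int (x - 1))) / (2 :: real)"
proof -
  have "cos (\<theta> * of_int (x + 1)) + cos (\<theta> * of_int (x - 1)) = 2 * (cos \<theta> * cos (\<theta> * of_int x))"
    by (simp add: distrib_left right_diff_distrib cos_add cos_diff)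
  then show ?thesis by (simp only: distrib_left[symmetric] power_Suc) simp
qed

text \<open>For this \<open>\<theta>\<close> the eigenfunction vanishes at \<open>\<plusminus> (r + 1)\<close>, the first positions
  outside the interval, and is at most \<open>1\<close> inside; so it is a subsolution of the recursion for
  \<open>stay_prob\<close>.\<close>
lemma stay_prob_ge:
  assumes "\<theta> = pi / (2 * real (r + 1))" and "\<bar>x\<bar> \<le> int r + 1"
  shows "cos \<theta> ^ n * cos (\<theta> * of_int x) \<le> stay_prob r n x"
proof -
  have edge: "cos (\<theta> * of_int x) = 0" if "\<bar>x\<bar> \<le> int r + 1" "\<not> \<bar>x\<bar> \<le> int r" for x
  proof -
    have "\<theta> * real (r + 1) = pi / 2" by (simp add: assms(1) field_simps)
    moreover have "of_int x = real (r + 1) \<or> of_int x = - real (r + 1)" using that by linarith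
    ultimately have "\<theta> * of_int x = pi / 2 \<or> \<theta> * of_int x = - (pi / 2)"
      by (metis mult_minus_right)
    then show ?thesis by (metis cos_minus cos_pi_half)
  qed
  show ?thesis using assms(2)
  proof (induction n arbitrary: x)
    case 0
    then show ?case by (cases "\<bar>x\<bar> \<le> int r") (auto simp: edge)
  next
    case (Suc n)
    show ?case
    proof (cases "\<bar>x\<bar> \<le> int r")
      case True
      have "cos \<theta> ^ Suc n * cos (\<theta> * of_int x) \<le> (stay_prob r n (x + 1) + stay_prob r n (x - 1)) / 2"
        unfolding cos_eigenfunction
        using True by (intro divide_right_mono add_mono Suc.IH) auto
      then show ?thesis using True by simp
    next
      case False
      then show ?thesis using Suc.prems by (simp add: edge)
    qed
  qed
qed

lemma cos_1_ge_half: "1 / 2 \<le> cos (1 :: real)"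
proof -
  have "cos (pi / 3) \<le> cos (1 :: real)"
    using pi_gt3 by (intro cos_monotone_0_pi_le) auto
  then show ?thesis by (simp add: cos_60)
qed

text \<open>For this \<open>\<theta>\<close> twice the eigenfunction is still at least \<open>1\<close> up to the positions
  \<open>\<plusminus> (r + 1)\<close>, because \<open>cos 1 \<ge> 1 / 2\<close>; so it is a supersolution of the recursion for
  \<open>stay_prob\<close>.\<close>
lemma stay_prob_le:
  assumes "\<theta> = 1 / real (r + 1)" and "\<bar>x\<bar> \<le> int r + 1"
  shows "stay_prob r n x \<le> 2 * (cos \<theta> ^ n * cos (\<theta> * of_int x))"
  using assms(2)
proof (induction n arbitrary: x)
  case 0
  have "\<bar>\<theta> * of_int x\<bar> \<le> 1" using 0 unfolding assms(1) abs_mult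
    by (simp add: field_simps)
  then have "cos 1 \<le> cos \<bar>\<theta> * of_int x\<bar>"
    using pi_gt3 by (intro cos_monotone_0_pi_le) auto
  then have "1 / 2 \<le> cos (\<theta> * of_int x)" using cos_1_ge_half by simp
  then show ?case by auto
next
  case (Suc n)
  have "\<bar>\<theta> * of_int x\<bar> \<le> 1" using Suc.prems unfolding assms(1) abs_mult
    by (simp add: field_simps)
  then have "cos 1 \<le> cos \<bar>\<theta> * of_int x\<bar>"
    using pi_gt3 by (intro cos_monotone_0_pi_le) auto
  then have cx: "0 \<le> cos (\<theta> * of_int x)" using cos_1_ge_half by simp
  have "\<theta> \<le> 1" "0 \<le> \<theta>" unfolding assms(1) by auto
  then have ct: "0 \<le> cos \<theta>" using pi_gt3 by (intro cos_ge_zero) auto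
  show ?case
  proof (cases "\<bar>x\<bar> \<le> int r")
    case True
    have "stay_prob r (Suc n) x = (stay_prob r n (x + 1) + stay_prob r n (x - 1)) / 2"
      using True by simp
    also have "\<dots> \<le> (2 * (cos \<theta> ^ n * cos (\<theta> * of_int (x + 1))) + 2 * (cos \<theta> ^ n * cos (\<theta> * of_int (x - 1)))) / 2"
      using True by (intro divide_right_mono add_mono Suc.IH) auto
    finally show ?thesis unfolding cos_eigenfunction by simp
  next
    case False
    then show ?thesis using cx ct by (simp add: stay_prob_outside)
  qed
qed

lemma cos_le_exp:
  assumes "0 \<le> \<theta>" "\<theta> \<le> (1 :: real)"
  shows "cos \<theta> \<le> exp (- (\<theta>\<^sup>2 / 4))"
proof (cases "\<theta> = 0")
  case False
  then obtain t where t: "cos \<theta> = (\<Sum>m<4. cos_coeff m * \<theta> ^ m) + cos (t + 1 / 2 * real 4 * pi) / fact 4 * \<theta> ^ 4"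
    using Maclaurin_cos_expansion2[of \<theta> 4] assms by auto
  have "(\<Sum>m<4. cos_coeff m * \<theta> ^ m) = 1 - \<theta>\<^sup>2 / 2"
  proof -
    have "{..<4} = {0, 1, 2, 3 :: nat}" by auto
    then show ?thesis by (simp add: cos_coeff_def)
  qed
  moreover have "cos (t + 1 / 2 * real 4 * pi) / fact 4 * \<theta> ^ 4 \<le> 1 / fact 4 * \<theta> ^ 4"
    by (intro mult_right_mono divide_right_mono) auto
  moreover have "1 / fact 4 * \<theta> ^ 4 \<le> \<theta>\<^sup>2 / 4"
  proof -
    have "\<theta> ^ 4 \<le> \<theta> ^ 2" using assms by (intro power_decreasing) auto
    moreover have "fact 4 = (24 :: real)" by (simp add: fact_numeral)
    ultimately show ?thesis using zero_le_power2[of \<theta>] by (simp only:)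
  qed
  ultimately have "cos \<theta> \<le> 1 - \<theta>\<^sup>2 / 4" using t by linarith
  also have "\<dots> \<le> exp (- (\<theta>\<^sup>2 / 4))" using exp_ge_add_one_self[of "- (\<theta>\<^sup>2 / 4)"] by simp
  finally show ?thesis .
qed auto

lemma exp_le_cos:
  assumes "\<bar>\<theta>\<bar> \<le> (1 :: real)"
  shows "exp (- \<theta>\<^sup>2) \<le> cos \<theta>"
proof -
  have "\<theta>\<^sup>2 \<le> 1" using assms by (simp add: abs_square_le_1)
  have "exp (- \<theta>\<^sup>2) = 1 / exp (\<theta>\<^sup>2)" by (simp add: exp_minus field_simps)
  also have "\<dots> \<le> 1 / (1 + \<theta>\<^sup>2)"
    by (intro divide_left_mono) (auto intro!: mult_pos_pos add_pos_nonneg)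
  also have "\<dots> \<le> 1 - \<theta>\<^sup>2 / 2"
  proof -
    have "\<theta>\<^sup>2 * \<theta>\<^sup>2 \<le> 1 * \<theta>\<^sup>2" using \<open>\<theta>\<^sup>2 \<le> 1\<close> by (intro mult_right_mono) auto
    then have "1 \<le> (1 - \<theta>\<^sup>2 / 2) * (1 + \<theta>\<^sup>2)" by (simp add: field_simps)
    then show ?thesis by (simp add: pos_divide_le_eq add_pos_nonneg)
  qed
  also have "\<dots> \<le> 1 - 2 * (sin (\<theta> / 2))\<^sup>2"
  proof -
    have "(sin (\<theta> / 2))\<^sup>2 \<le> (\<theta> / 2)\<^sup>2"
      using abs_sin_x_le_abs_x[of "\<theta> / 2"] by (metis abs_le_square_iff)
    then show ?thesis by (simp add: power2_eq_square)
  qed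
  also have "\<dots> = cos \<theta>" using cos_double_sin[of "\<theta> / 2"] by simp
  finally show ?thesis .
qed

lemma stay_prob_upper: "1 \<le> r \<Longrightarrow> stay_prob r (r ^ 3) 0 \<le> 2 * exp (- real r / 16)"
proof -
  assume r: "1 \<le> r"
  define \<theta> where "\<theta> = 1 / real (r + 1)"
  have \<theta>: "0 \<le> \<theta>" "\<theta> \<le> 1" by (auto simp: \<theta>_def)
  have "stay_prob r (r ^ 3) 0 \<le> 2 * cos \<theta> ^ (r ^ 3)"
    using stay_prob_le[OF \<theta>_def, of 0 "r ^ 3"] by simp
  also have "cos \<theta> ^ (r ^ 3) \<le> exp (- (\<theta>\<^sup>2 / 4)) ^ (r ^ 3)"
    using cos_le_exp[OF \<theta>] \<theta> pi_gt3 by (intro power_mono cos_ge_zero) auto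
  also have "\<dots> = exp (- (real (r ^ 3) * \<theta>\<^sup>2 / 4))" by (simp add: exp_of_nat_mult[symmetric])
  also have "\<dots> \<le> exp (- real r / 16)"
  proof -
    have "1 / (2 * real r) \<le> \<theta>" using r by (simp add: \<theta>_def field_simps)
    then have "(1 / (2 * real r))\<^sup>2 \<le> \<theta>\<^sup>2" by (intro power_mono) auto
    then have "real r ^ 3 * (1 / (2 * real r))\<^sup>2 \<le> real r ^ 3 * \<theta>\<^sup>2" by (intro mult_left_mono) auto
    moreover have "real r ^ 3 * (1 / (2 * real r))\<^sup>2 = real r / 4"
      using r by (simp add: power2_eq_square power3_eq_cube)
    ultimately show ?thesis by simp
  qed
  finally show ?thesis by simp
qed

lemma stay_prob_lower:
  assumes "1 \<le> r"
  shows "exp (- 4 * real n / (real r)\<^sup>2) \<le> stay_prob r n 0"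
proof -
  define \<theta> where "\<theta> = pi / (2 * real (r + 1))"
  have "\<theta> \<le> 1" using assms pi_less_4 by (simp add: \<theta>_def field_simps)
  moreover have \<theta>0: "0 \<le> \<theta>" by (simp add: \<theta>_def)
  ultimately have "exp (- \<theta>\<^sup>2) \<le> cos \<theta>" by (intro exp_le_cos) auto
  then have "exp (- \<theta>\<^sup>2) ^ n \<le> cos \<theta> ^ n" by (intro power_mono) auto
  also have "\<dots> \<le> stay_prob r n 0" using stay_prob_ge[OF \<theta>_def, of 0 n] by simp
  also have "exp (- \<theta>\<^sup>2) ^ n = exp (- (real n * \<theta>\<^sup>2))" by (simp add: exp_of_nat_mult[symmetric])
  finally have "exp (- (real n * \<theta>\<^sup>2)) \<le> stay_prob r n 0" .
  moreover have "\<theta> \<le> 2 / real r"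
  proof -
    have "\<theta> \<le> 4 / (2 * real r)" unfolding \<theta>_def using assms pi_less_4 by (intro frac_le) auto
    then show ?thesis by simp
  qed
  then have "\<theta>\<^sup>2 \<le> (2 / real r)\<^sup>2" using \<theta>0 by (intro power_mono) auto
  then have "real n * \<theta>\<^sup>2 \<le> real n * (2 / real r)\<^sup>2" by (intro mult_left_mono) auto
  then have "exp (- 4 * real n / (real r)\<^sup>2) \<le> exp (- (real n * \<theta>\<^sup>2))"
    by (simp add: power_divide mult.commute)
  ultimately show ?thesis by linarith
qed

section \<open>First arrivals and the two-cycle trap\<close>

text \<open>This is the first visit to a column \<open>x \<ge> 0\<close>, with the walk kept in a box of size \<open>m\<close> until then.
  The box makes the event depend on finitely many signs only, and, among the columns, on those
  to the left of \<open>x\<close>.\<close>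
definition arrives :: "int \<Rightarrow> (int \<Rightarrow> int) \<Rightarrow> (int \<Rightarrow> int) \<Rightarrow> int \<Rightarrow> nat \<Rightarrow> bool" where
  "arrives m u v x T \<longleftrightarrow> fst (walk u v T) = x \<and> (\<forall>i<T. fst (walk u v i) < x) \<and>
    (\<forall>i\<le>T. - m \<le> fst (walk u v i) \<and> \<bar>snd (walk u v i)\<bar> \<le> m)"

text \<open>On its first visit to the column \<open>x\<close> the walk turns back at once. This puts it to the test: it is
  trapped unless the columns \<open>x - 1\<close> and \<open>x\<close> have equal signs.\<close>
definition tested :: "int \<Rightarrow> (int \<Rightarrow> int) \<Rightarrow> (int \<Rightarrow> int) \<Rightarrow> int \<Rightarrow> bool" where
  "tested m u v x \<longleftrightarrow> (\<exists>T. arrives m u v x T \<and> u (snd (walk u v T)) = -1)"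

lemma arrives_walk_cong:
  assumes "arrives m u v x T" and "\<And>y. \<bar>y\<bar> \<le> m \<Longrightarrow> u' y = u y"
    and "\<And>z. - m \<le> z \<Longrightarrow> z < x \<Longrightarrow> v' z = v z" and "i \<le> T"
  shows "walk u' v' i = walk u v i"
  using assms(4)
proof (induction i)
  case (Suc i)
  then have "walk u' v' i = walk u v i" "i < T" by auto
  moreover have "u' (snd (walk u v i)) = u (snd (walk u v i))"
      "v' (fst (walk u v i)) = v (fst (walk u v i))"
    using assms(1-3) \<open>i < T\<close> by (auto simp: arrives_def)
  ultimately show ?case by simp
qed simp

lemma arrives_cong:
  assumes "arrives m u v x T" and "\<And>y. \<bar>y\<bar> \<le> m \<Longrightarrow> u' y = u y"
    and "\<And>z. - m \<le> z \<Longrightarrow> z < x \<Longrightarrow> v' z = v z"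
  shows "arrives m u' v' x T"
  using assms(1) arrives_walk_cong[OF assms] by (simp add: arrives_def)

text \<open>A test at the column \<open>x\<close> is decided before the sign of this column is used.\<close>
lemma tested_cong:
  assumes "\<And>y. \<bar>y\<bar> \<le> m \<Longrightarrow> u' y = u y" and "\<And>z. - m \<le> z \<Longrightarrow> z < x \<Longrightarrow> v' z = v z"
  shows "tested m u' v' x = tested m u v x"
proof -
  have imp: "tested m u' v' x"
    if t: "tested m u v x" and u: "\<And>y. \<bar>y\<bar> \<le> m \<Longrightarrow> u' y = u y"
      and v: "\<And>z. - m \<le> z \<Longrightarrow> z < x \<Longrightarrow> v' z = v z" for u v u' v' :: "int \<Rightarrow> int"
  proof -
    obtain T where T: "arrives m u v x T" "u (snd (walk u v T)) = -1"
      using t by (auto simp: tested_def)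
    have "\<bar>snd (walk u v T)\<bar> \<le> m" using T(1) by (simp add: arrives_def)
    then have "u' (snd (walk u' v' T)) = -1"
      using T(2) u arrives_walk_cong[OF T(1) u v order.refl] by simp
    then show ?thesis using arrives_cong[OF T(1) u v] by (auto simp: tested_def)
  qed
  show ?thesis using imp[of u v u' v'] imp[of u' v' u v] assms by metis
qed

context
  fixes u v :: "int \<Rightarrow> int"
  assumes u: "\<And>y. u y = -1 \<or> u y = 1" and v: "\<And>x. v x = -1 \<or> v x = 1"
begin

lemma fst_step: "\<bar>fst (walk u v (Suc i)) - fst (walk u v i)\<bar> = 1"
  using u[of "snd (walk u v i)"] by auto

lemma snd_step: "\<bar>snd (walk u v (Suc i)) - snd (walk u v i)\<bar> = 1"
  using v[of "fst (walk u v i)"] by auto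

lemma first_arrival:
  assumes "arrives m u v x T" "0 \<le> x'" "x' \<le> x"
  obtains T' where "arrives m u v x' T'" "T' \<le> T"
proof -
  define T' where "T' = (LEAST i. x' \<le> fst (walk u v i))"
  have T: "x' \<le> fst (walk u v T)" using assms by (simp add: arrives_def)
  then have T'T: "T' \<le> T" unfolding T'_def by (rule Least_le)
  have ge: "x' \<le> fst (walk u v T')" unfolding T'_def using T by (rule LeastI)
  have lt: "fst (walk u v i) < x'" if "i < T'" for i
    using not_less_Least[of i "\<lambda>i. x' \<le> fst (walk u v i)"] that by (simp add: T'_def)
  have "fst (walk u v T') = x'"
  proof (cases T')
    case 0
    then show ?thesis using ge assms by simp
  next
    case (Suc i)
    show ?thesis using ge lt[of i] fst_step[of i] unfolding Suc by linarith
  qed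
  then have "arrives m u v x' T'"
    using lt T'T assms(1) by (auto simp: arrives_def)
  then show ?thesis using T'T that by blast
qed

text \<open>The step into the column \<open>x\<close> is \<open>(1, v (x - 1))\<close> and the next one is \<open>(-1, v x)\<close>, its opposite.
  So the walk returns to the point that it has just left and has period two from then on.\<close>
lemma trapped:
  assumes T: "arrives m u v x T" "u (snd (walk u v T)) = -1" and x: "1 \<le> x" and ne: "v x \<noteq> v (x - 1)"
  shows "fst (walk u v i) \<le> x"
proof -
  obtain S where S: "T = Suc S" using T x by (cases T) (auto simp: arrives_def)
  have "fst (walk u v S) < x" "fst (walk u v T) = x" using T S by (auto simp: arrives_def)
  then have xS: "fst (walk u v S) = x - 1" using fst_step[of S] unfolding S by linarith
  have "v x = - v (x - 1)" using ne v[of x] v[of "x - 1"] by auto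
  then have per: "walk u v (Suc (Suc S)) = walk u v S"
    using T(2) S xS \<open>fst (walk u v T) = x\<close> by (simp add: prod_eq_iff)
  have "walk u v (S + 2 * k) = walk u v S \<and> walk u v (Suc (S + 2 * k)) = walk u v T" for k
  proof (induction k)
    case (Suc k)
    have "walk u v (S + 2 * Suc k) = walk u v S"
      using per Suc by (simp add: S)
    then show ?case by (simp add: S)
  qed (simp add: S)
  then have cyc: "fst (walk u v (S + 2 * k)) \<le> x" "fst (walk u v (Suc (S + 2 * k))) \<le> x" for k
    using xS \<open>fst (walk u v T) = x\<close> by (simp_all del: walk.simps)
  show ?thesis
  proof (cases "i < S")
    case True
    then show ?thesis using T S by (auto simp: arrives_def intro: less_imp_le)
  next
    case False
    then obtain d where d: "i = S + d" by (metis le_Suc_ex not_less)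
    then show ?thesis using cyc[of "d div 2"] by (cases "even d") (auto elim!: evenE oddE)
  qed
qed

lemma test_passed:
  assumes "arrives m u v x' T'" "x < x'" "1 \<le> x" "tested m u v x"
  shows "v x = v (x - 1)"
proof (rule ccontr)
  assume "v x \<noteq> v (x - 1)"
  then have "fst (walk u v T') \<le> x" using assms(3,4) trapped by (auto simp: tested_def)
  then show False using assms by (simp add: arrives_def)
qed

text \<open>Without a test the walk goes straight on to the next column; the assumption that a column
  \<open>M\<close> farther to the right is reached within the box keeps this step inside the box.\<close>
lemma untested_step:
  assumes reach: "arrives m u v M T\<^sub>M" "x < M" "0 \<le> x"
    and T: "arrives m u v x T" and nt: "\<not> tested m u v x"
  shows "arrives m u v (x + 1) (Suc T)" "snd (walk u v (Suc T)) = snd (walk u v T) + v x"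
    "u (snd (walk u v T)) = 1"
proof -
  show u1: "u (snd (walk u v T)) = 1" using nt T u by (auto simp: tested_def)
  have x: "fst (walk u v T) = x" using T by (simp add: arrives_def)
  then show "snd (walk u v (Suc T)) = snd (walk u v T) + v x" by simp
  obtain T' where T': "arrives m u v (x + 1) T'" using first_arrival[OF reach(1), of "x + 1"] reach by auto
  have x1: "fst (walk u v (Suc T)) = x + 1" using u1 x by simp
  have "\<not> T' \<le> T" using T T' x by (auto simp: arrives_def le_less)
  moreover have "\<not> Suc T < T'" using T' x1 unfolding arrives_def by (metis less_irrefl)
  ultimately have "T' = Suc T" by simp
  then show "arrives m u v (x + 1) (Suc T)" using T' by simp
qed

lemma untested_block:
  assumes reach: "arrives m u v M T\<^sub>M" "0 \<le> x" "x + int n \<le> M"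
    and T: "arrives m u v x T" and nt: "\<And>j. j < n \<Longrightarrow> \<not> tested m u v (x + int j)" and "k \<le> n"
  shows "arrives m u v (x + int k) (T + k) \<and>
    snd (walk u v (T + k)) = snd (walk u v T) + (\<Sum>i<k. v (x + int i))"
  using \<open>k \<le> n\<close>
proof (induction k)
  case 0
  then show ?case using T by simp
next
  case (Suc k)
  then show ?case
    using untested_step[OF reach(1), of "x + int k" "T + k"] nt[of k] reach(2,3)
    by (simp add: algebra_simps)
qed

lemma interval_visited:
  assumes "a \<le> b" "snd (walk u v a) \<le> y \<and> y \<le> snd (walk u v b) \<or> snd (walk u v b) \<le> y \<and> y \<le> snd (walk u v a)"
  obtains i where "a \<le> i" "i \<le> b" "snd (walk u v i) = y"
proof (cases "snd (walk u v a) \<le> y \<and> y \<le> snd (walk u v b)")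
  case True
  then have "\<exists>i. a \<le> i \<and> i \<le> b \<and> snd (walk u v i) = y"
    using snd_step by (intro nat_intermed_int_val) (auto simp: assms simp del: walk.simps)
  then show ?thesis using that by auto
next
  case False
  have st: "\<bar>- snd (walk u v (Suc i)) - - snd (walk u v i)\<bar> \<le> 1" for i
    using snd_step[of i] by linarith
  have "\<exists>i. a \<le> i \<and> i \<le> b \<and> - snd (walk u v i) = - y"
    using st assms False by (intro nat_intermed_int_val) (auto simp del: walk.simps)
  then show ?thesis using that by auto
qed

text \<open>The height changes by one unit per step, so the walk visits every row between two of its heights,
  and all rows visited before an untested step have sign \<open>1\<close>. Hence two such heights differ by less
  than \<open>r\<close>. The last height of the block need not lie in a row of sign \<open>1\<close>; it adds at most one
  to the difference.\<close>
lemma untested_block_confined: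
  assumes reach: "arrives m u v M T\<^sub>M" "0 \<le> x" "x + int n \<le> M" and r: "1 \<le> r"
    and nt: "\<And>j. j < n \<Longrightarrow> \<not> tested m u v (x + int j)"
    and rows: "\<And>y. - m \<le> y \<Longrightarrow> y + int r \<le> m + 1 \<Longrightarrow> \<exists>k<r. u (y + int k) \<noteq> 1"
    and "k \<le> n"
  shows "\<bar>\<Sum>i<k. v (x + int i)\<bar> \<le> int r"
proof (cases k)
  case 0
  then show ?thesis by simp
next
  case (Suc k')
  obtain T where T: "arrives m u v x T" using first_arrival[OF reach(1,2)] reach by auto
  note block = untested_block[OF reach T nt]
  define a b where "a = snd (walk u v T)" and "b = snd (walk u v (T + k'))"
  have k': "k' < n" using Suc \<open>k \<le> n\<close> by simp
  have all1: "u y = 1" if y: "min a b \<le> y" "y \<le> max a b" for y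
  proof -
    obtain i where i: "T \<le> i" "i \<le> T + k'" "snd (walk u v i) = y"
      using interval_visited[of T "T + k'" y] y by (auto simp: a_def b_def min_def max_def split: if_splits)
    obtain d where d: "i = T + d" "d \<le> k'" using i by (auto simp: le_iff_add)
    have "arrives m u v (x + int d) (T + d)" using block[of d] d k' by simp
    from untested_step(3)[OF reach(1) _ _ this] nt[of d] d k' reach i show ?thesis by simp
  qed
  have bnd: "\<bar>a\<bar> \<le> m" "\<bar>b\<bar> \<le> m"
    using block[of k'] k' T by (auto simp: arrives_def a_def b_def)
  have "\<bar>b - a\<bar> < int r"
  proof (rule ccontr)
    assume "\<not> \<bar>b - a\<bar> < int r"
    then have ge: "min a b + int r \<le> max a b" by (auto simp: min_def max_def split: if_splits)
    then have "\<exists>k<r. u (min a b + int k) \<noteq> 1"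
      using bnd by (intro rows) auto
    then obtain k where "k < r" "u (min a b + int k) \<noteq> 1" by blast
    then show False using all1[of "min a b + int k"] ge by auto
  qed
  moreover have "b = a + (\<Sum>i<k'. v (x + int i))" using block[of k'] k' by (simp add: a_def b_def)
  moreover have "(\<Sum>i<k. v (x + int i)) = (\<Sum>i<k'. v (x + int i)) + v (x + int k')" using Suc by simp
  ultimately show ?thesis using v[of "x + int k'"] by auto
qed

lemma walk_exits_box:
  assumes "m > 0" "m \<le> \<bar>fst (walk u v i)\<bar> \<or> m \<le> \<bar>snd (walk u v i)\<bar>"
  obtains T where "\<And>j. j < T \<Longrightarrow> \<bar>fst (walk u v j)\<bar> < m \<and> \<bar>snd (walk u v j)\<bar> < m"
    "\<bar>fst (walk u v T)\<bar> \<le> m" "\<bar>snd (walk u v T)\<bar> \<le> m"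
    "\<bar>fst (walk u v T)\<bar> = m \<or> \<bar>snd (walk u v T)\<bar> = m"
proof -
  define out where "out j \<longleftrightarrow> m \<le> \<bar>fst (walk u v j)\<bar> \<or> m \<le> \<bar>snd (walk u v j)\<bar>" for j
  define T where "T = (LEAST j. out j)"
  have outT: "out T" unfolding T_def using assms(2) by (intro LeastI[of out i]) (simp add: out_def)
  have before: "\<not> out j" if "j < T" for j using that not_less_Least unfolding T_def by blast
  have "\<bar>fst (walk u v T)\<bar> \<le> m \<and> \<bar>snd (walk u v T)\<bar> \<le> m"
  proof (cases T)
    case 0
    then show ?thesis using assms by simp
  next
    case (Suc j)
    show ?thesis using before[of j] fst_step[of j] snd_step[of j] unfolding out_def Suc by linarith
  qed
  with outT before show ?thesis by (intro that[of T]) (auto simp: out_def not_le)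
qed

end

section \<open>Leaving a box through its right side\<close>

lemma walk_swap: "walk v u i = (snd (walk u v i), fst (walk u v i))"
  by (induction i) auto

lemma walk_reflect: "walk (\<lambda>y. - u y) (\<lambda>x. v (- x)) i = (- fst (walk u v i), snd (walk u v i))"
  by (induction i) auto

definition exits_right :: "int \<Rightarrow> (int \<Rightarrow> int) \<Rightarrow> (int \<Rightarrow> int) \<Rightarrow> bool" where
  "exits_right m u v \<longleftrightarrow> (\<exists>T. arrives m u v m T)"

lemma exits_right_cong:
  assumes "\<And>y. \<bar>y\<bar> \<le> m \<Longrightarrow> u' y = u y" and "\<And>z. \<bar>z\<bar> \<le> m \<Longrightarrow> v' z = v z"
  shows "exits_right m u' v' = exits_right m u v"
  unfolding exits_right_def
  using arrives_cong[of m u v m _ u' v'] arrives_cong[of m u' v' m _ u v] assms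
  by (metis abs_le_iff less_imp_le minus_le_iff)

text \<open>Reflections and the exchange of the axes turn walks of this kind into walks of the same
  kind, so the four sides of the box reduce to the right one.\<close>
lemma exits_some_side:
  assumes u: "\<And>y. u y = -1 \<or> u y = 1" and v: "\<And>x. v x = -1 \<or> v x = 1"
    and "m > 0" "m \<le> \<bar>fst (walk u v i)\<bar> \<or> m \<le> \<bar>snd (walk u v i)\<bar>"
  shows "exits_right m u v \<or> exits_right m (\<lambda>y. - u y) (\<lambda>x. v (- x)) \<or>
    exits_right m v u \<or> exits_right m (\<lambda>x. - v x) (\<lambda>y. u (- y))"
proof -
  obtain T where T: "\<And>j. j < T \<Longrightarrow> \<bar>fst (walk u v j)\<bar> < m \<and> \<bar>snd (walk u v j)\<bar> < m"
    "\<bar>fst (walk u v T)\<bar> \<le> m" "\<bar>snd (walk u v T)\<bar> \<le> m"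
    "\<bar>fst (walk u v T)\<bar> = m \<or> \<bar>snd (walk u v T)\<bar> = m"
    using walk_exits_box[OF assms] by blast
  have le: "\<bar>fst (walk u v j)\<bar> \<le> m" "\<bar>snd (walk u v j)\<bar> \<le> m" if "j \<le> T" for j
    using T that by (auto simp: le_less)
  have a: "m = fst (walk u v T) \<or> m = - fst (walk u v T) \<or> m = snd (walk u v T) \<or> m = - snd (walk u v T)"
    using T(4) by linarith
  have lt: "fst (walk u v j) < m" "- fst (walk u v j) < m" "snd (walk u v j) < m" "- snd (walk u v j) < m"
    if "j < T" for j using T(1)[OF that] by linarith+
  have le': "- m \<le> fst (walk u v j)" "fst (walk u v j) \<le> m" "- m \<le> snd (walk u v j)" "snd (walk u v j) \<le> m"
    if "j \<le> T" for j using le[OF that] by linarith+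
  have "arrives m u v m T \<or> arrives m (\<lambda>y. - u y) (\<lambda>x. v (- x)) m T \<or>
    arrives m v u m T \<or> arrives m (\<lambda>x. - v x) (\<lambda>y. u (- y)) m T"
    unfolding arrives_def walk_reflect walk_swap[of v u] fst_conv snd_conv
    using a lt le le' by auto
  then show ?thesis by (auto simp: exits_right_def)
qed

definition box_coins :: "int \<Rightarrow> (int + int) set" where
  "box_coins m = Inl ` {-m..m} \<union> Inr ` {-m..m}"

lemma mem_box_coins: "Inl y \<in> box_coins m \<longleftrightarrow> \<bar>y\<bar> \<le> m" "Inr x \<in> box_coins m \<longleftrightarrow> \<bar>x\<bar> \<le> m"
  by (auto simp: box_coins_def image_iff)

lemma finite_box_coins: "finite (box_coins m)"
  by (simp add: box_coins_def)

text \<open>Pigeonhole principle: fewer than \<open>r\<close> elements cannot meet all of \<open>r\<close> disjoint blocks.\<close>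
lemma untested_block_exists:
  assumes "card {j \<in> {0..<r * l}. P j} < r" "0 < l"
  obtains b where "b < r" "\<And>i. i < l \<Longrightarrow> \<not> P (b * l + i)"
proof -
  have "\<not> {..<r} \<subseteq> (\<lambda>j. j div l) ` {j \<in> {0..<r * l}. P j}"
    using surj_card_le[of "{j \<in> {0..<r * l}. P j}" "{..<r}" "\<lambda>j. j div l"] assms by auto
  then obtain b where b: "b < r" "b \<notin> (\<lambda>j. j div l) ` {j \<in> {0..<r * l}. P j}" by auto
  have "\<not> P (b * l + i)" if "i < l" for i
  proof
    assume "P (b * l + i)"
    moreover have "b * l + i < r * l"
    proof -
      have "b * l + i < (b + 1) * l" using that by simp
      also have "\<dots> \<le> r * l" using b(1) by (intro mult_right_mono) auto
      finally show ?thesis .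
    qed
    moreover have "(b * l + i) div l = b" using that by simp
    ultimately have "b \<in> (\<lambda>j. j div l) ` {j \<in> {0..<r * l}. P j}"
      by (intro rev_image_eqI[of "b * l + i"]) simp_all
    then show False using b(2) by blast
  qed
  then show ?thesis using b(1) that by blast
qed

lemma exits_right_alternatives:
  assumes u: "\<And>y. u y = -1 \<or> u y = 1" and v: "\<And>x. v x = -1 \<or> v x = 1"
    and r: "1 \<le> r" and m: "m = int (r ^ 4) + 1" and ex: "exits_right m u v"
  shows "(\<exists>y\<in>{-m..m}. y + int r \<le> m + 1 \<and> (\<forall>k<r. u (y + int k) = 1)) \<or>
    (\<exists>b\<in>{..<r}. \<forall>k\<le>r ^ 3. \<bar>\<Sum>i<k. v (int (b * r ^ 3) + 1 + int i)\<bar> \<le> int r) \<or>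
    r \<le> card {j \<in> {0..<r ^ 4}. tested m u v (int j + 1)}"
proof -
  have r4: "r ^ 4 = r * r ^ 3" by (simp add: eval_nat_numeral)
  obtain T\<^sub>M where reach: "arrives m u v m T\<^sub>M" using ex by (auto simp: exits_right_def)
  have "\<exists>b\<in>{..<r}. \<forall>k\<le>r ^ 3. \<bar>\<Sum>i<k. v (int (b * r ^ 3) + 1 + int i)\<bar> \<le> int r"
    if rows: "\<not> (\<exists>y\<in>{-m..m}. y + int r \<le> m + 1 \<and> (\<forall>k<r. u (y + int k) = 1))"
      and few: "\<not> r \<le> card {j \<in> {0..<r ^ 4}. tested m u v (int j + 1)}"
  proof -
    obtain b where b: "b < r" "\<And>i. i < r ^ 3 \<Longrightarrow> \<not> tested m u v (int (b * r ^ 3 + i) + 1)"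
      using untested_block_exists[of r "r ^ 3" "\<lambda>j. tested m u v (int j + 1)"] few r r4 by auto
    have "\<bar>\<Sum>i<k. v (int (b * r ^ 3) + 1 + int i)\<bar> \<le> int r" if "k \<le> r ^ 3" for k
    proof (rule untested_block_confined[OF u v reach _ _ r])
      have "(b + 1) * r ^ 3 \<le> r * r ^ 3" using b(1) by (intro mult_right_mono) auto
      then have "b * r ^ 3 + 1 + r ^ 3 \<le> r ^ 4 + 1" by (simp add: r4)
      then have "int (b * r ^ 3 + 1 + r ^ 3) \<le> int (r ^ 4 + 1)" by (simp only: of_nat_le_iff)
      then show "int (b * r ^ 3) + 1 + int (r ^ 3) \<le> m"
        unfolding m by (simp only: of_nat_add of_nat_1)
      show "\<not> tested m u v (int (b * r ^ 3) + 1 + int j)" if "j < r ^ 3" for j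
        using b(2)[OF that] by (simp add: algebra_simps)
      show "\<exists>k<r. u (y + int k) \<noteq> 1" if "- m \<le> y" "y + int r \<le> m + 1" for y
      proof -
        have "y \<in> {-m..m}" using that r by auto
        then show ?thesis using rows that(2) by blast
      qed
    qed (use that in simp_all)
    then show ?thesis using b(1) by blast
  qed
  then show ?thesis by blast
qed

text \<open>The summands with the factor \<open>(1 / 2) ^ r\<close> account for \<open>2 * r ^ 4 + 3\<close> positions of \<open>r\<close> rows of
  sign \<open>1\<close> and for the event that \<open>r\<close> tests are passed; the last summand accounts for \<open>r\<close> blocks of
  columns with a confined random walk.\<close>
definition exit_bound :: "nat \<Rightarrow> real" where
  "exit_bound r = (2 * real r ^ 4 + 4) * (1 / 2) ^ r + 2 * real r * exp (- real r / 16)"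

lemma coin_prob_exits_right:
  assumes r: "1 \<le> r" and m: "m = int (r ^ 4) + 1"
  shows "coin_prob (box_coins m) (\<lambda>f. exits_right m (\<lambda>y. f (Inl y)) (\<lambda>x. f (Inr x))) \<le> exit_bound r"
proof -
  let ?J = "box_coins m"
  note J = finite_box_coins[of m]
  define row where "row y f \<longleftrightarrow> y + int r \<le> m + 1 \<and> (\<forall>k<r. f (Inl (y + int k) :: int + int) = (1 :: int))" for y f
  define narrow where "narrow b f \<longleftrightarrow>
      (\<forall>k\<le>r ^ 3. \<bar>0 + (\<Sum>i<k. f (Inr (int (b * r ^ 3) + 1 + int i) :: int + int))\<bar> \<le> int r)" for b f
  define ex where "ex f \<longleftrightarrow> exits_right m (\<lambda>y. f (Inl y)) (\<lambda>x. f (Inr x))" for f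
  define test where "test j f \<longleftrightarrow> tested m (\<lambda>y. f (Inl y)) (\<lambda>x. f (Inr x)) (int j + 1)" for j f
  have 1: "coin_prob ?J (row y) \<le> (1 / 2) ^ r" if "y \<in> {-m..m}" for y
  proof (cases "y + int r \<le> m + 1")
    case True
    let ?I = "(\<lambda>k. Inl (y + int k) :: int + int) ` {..<r}"
    have "coin_prob ?J (row y) = coin_prob ?J (\<lambda>f. \<forall>i\<in>?I. f i = 1)"
      using True by (intro coin_prob_cong) (auto simp: row_def)
    also have "\<dots> = (1 / 2) ^ card ?I"
      using True that by (intro coin_prob_all_one[OF J]) (auto simp: box_coins_def)
    also have "card ?I = r" by (subst card_image) (auto simp: inj_on_def)
    finally show ?thesis by simp
  next
    case False
    then have "row y = (\<lambda>_. False)" by (auto simp: row_def fun_eq_iff)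
    then show ?thesis by (simp add: coin_prob_False)
  qed
  have 2: "coin_prob ?J (narrow b) \<le> 2 * exp (- real r / 16)" if "b \<in> {..<r}" for b
  proof -
    have "(b + 1) * r ^ 3 \<le> r * r ^ 3" using that by (intro mult_right_mono) auto
    then have "b * r ^ 3 + r ^ 3 \<le> r ^ 4" by (simp add: eval_nat_numeral)
    then have le: "int (b * r ^ 3) + int (r ^ 3) \<le> int (r ^ 4)"
      by (simp only: of_nat_add[symmetric] of_nat_le_iff)
    have "coin_prob ?J (narrow b) = coin_prob ?J (\<lambda>f. True \<and> narrow b f)" by simp
    also have "\<dots> = coin_prob ?J (\<lambda>_. True) * stay_prob r (r ^ 3) 0"
      unfolding narrow_def
    proof (rule coin_prob_confined[OF J])
      show "Inr (int (b * r ^ 3) + 1 + int i) \<in> ?J" if "i < r ^ 3" for i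
      proof -
        have "int i < int (r ^ 3)" using that by simp
        then have "int (b * r ^ 3) + 1 + int i \<le> m" using le m by linarith
        moreover have "- m \<le> int (b * r ^ 3) + 1 + int i" unfolding m by linarith
        ultimately show ?thesis by (simp add: mem_box_coins)
      qed
    qed (auto simp: inj_on_def)
    finally show ?thesis using stay_prob_upper[OF r] by (simp add: coin_prob_True[OF J])
  qed
  have "coin_prob ?J (\<lambda>f. True \<and> ex f \<and> r \<le> card {j \<in> {0..<r ^ 4}. test j f}) \<le>
      coin_prob ?J (\<lambda>_. True) / 2 ^ r"
  proof (rule repeated_tests[OF J, where c = "\<lambda>j. Inr (int j + 1)" and s = "\<lambda>j f. f (Inr (int j))"])
    show "Inr (int j + 1) \<in> ?J" if "j < r ^ 4" for j
    proof -
      have "int j < int (r ^ 4)" using that by simp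
      then have "int j + 1 \<le> m" "- m \<le> int j + 1" unfolding m by linarith+
      then show ?thesis by (simp add: mem_box_coins)
    qed
    show "test j (flip (Inr (int k + 1)) f) = test j f" if "j \<le> k" for j k f
      unfolding test_def using that by (intro tested_cong) (auto simp: flip_apply)
    show "flip (Inr (int k + 1)) f (Inr (int j)) = f (Inr (int j))" if "j \<le> k" for j k f
      using that by (simp add: flip_apply)
    show "f (Inr (int j)) \<in> {-1, 1}" if "f \<in> configs ?J" for j f
      using configs_sign[OF that] .
    show "f (Inr (int j + 1)) = f (Inr (int j))"
      if "f \<in> configs ?J" "ex f" "j < r ^ 4" "test j f" for j f
    proof -
      obtain T where T: "arrives m (\<lambda>y. f (Inl y)) (\<lambda>x. f (Inr x)) m T"
        using \<open>ex f\<close> by (auto simp: ex_def exits_right_def)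
      have "int j < int (r ^ 4)" using that by simp
      then have "int j + 1 < m" unfolding m by linarith
      then show ?thesis
        using test_passed[OF _ _ T, of "int j + 1"] configs_cases[OF that(1)] \<open>test j f\<close>
        by (simp add: test_def)
    qed
  qed (auto simp: inj_on_def)
  then have 3: "coin_prob ?J (\<lambda>f. ex f \<and> r \<le> card {j \<in> {0..<r ^ 4}. test j f}) \<le> (1 / 2) ^ r"
    by (simp add: coin_prob_True[OF J] power_one_over)
  have "coin_prob ?J ex \<le> coin_prob ?J (\<lambda>f. (\<exists>y\<in>{-m..m}. row y f) \<or> (\<exists>b\<in>{..<r}. narrow b f) \<or>
      (ex f \<and> r \<le> card {j \<in> {0..<r ^ 4}. test j f}))"
  proof (rule coin_prob_mono[OF J])
    fix f assume f: "f \<in> configs ?J" "ex f"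
    from exits_right_alternatives[OF _ _ r m f(2)[unfolded ex_def]] configs_cases[OF f(1)] f(2)
    show "(\<exists>y\<in>{-m..m}. row y f) \<or> (\<exists>b\<in>{..<r}. narrow b f) \<or>
      (ex f \<and> r \<le> card {j \<in> {0..<r ^ 4}. test j f})"
      unfolding row_def narrow_def test_def add_0 by blast
  qed
  also have "\<dots> \<le> coin_prob ?J (\<lambda>f. \<exists>y\<in>{-m..m}. row y f) + (coin_prob ?J (\<lambda>f. \<exists>b\<in>{..<r}. narrow b f) +
      coin_prob ?J (\<lambda>f. ex f \<and> r \<le> card {j \<in> {0..<r ^ 4}. test j f}))"
    by (intro order.trans[OF coin_prob_disj[OF J]] add_left_mono coin_prob_disj[OF J])
  also have "\<dots> \<le> real (card {-m..m}) * (1 / 2) ^ r + (real (card {..<r}) * (2 * exp (- real r / 16)) + (1 / 2) ^ r)"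
    by (intro add_mono coin_prob_Ex[OF J] 1 2 3) auto
  also have "real (card {-m..m}) = 2 * real r ^ 4 + 3"
    by (simp add: m)
  finally show ?thesis unfolding ex_def exit_bound_def by (simp add: algebra_simps)
qed

text \<open>The rate \<open>1 / 32\<close> is half of the rate of the dominant summand; the other half absorbs
  the polynomial factors.\<close>
lemma exit_bound_exponential:
  obtains K where "\<And>r. exit_bound r \<le> K * exp (- real r / 32)"
proof -
  define B where "B r = (2 * real r ^ 4 + 4) * exp (- real r / 2) + 2 * real r * exp (- real r / 16)" for r
  have "(\<lambda>r. B r * exp (real r / 32)) \<longlonglongrightarrow> 0"
    unfolding B_def by real_asymp
  then have "Bseq (\<lambda>r. B r * exp (real r / 32))"
    by (intro convergent_imp_Bseq) (auto simp: convergent_def)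
  then obtain K where K: "\<And>r. norm (B r * exp (real r / 32)) \<le> K" by (auto simp: Bseq_def)
  have half: "(1 / 2) ^ r \<le> exp (- real r / 2)" for r
  proof -
    have "1 / 2 \<le> exp (- 1 / 2 :: real)" using exp_ge_add_one_self[of "- 1 / 2"] by simp
    then have "(1 / 2) ^ r \<le> exp (- 1 / 2 :: real) ^ r" by (intro power_mono) auto
    then show ?thesis by (simp add: exp_of_nat_mult[symmetric])
  qed
  have "exit_bound r \<le> B r" for r
    unfolding exit_bound_def B_def by (intro add_mono mult_left_mono half) auto
  have "exit_bound r \<le> K * exp (- real r / 32)" for r
  proof -
    have "exit_bound r \<le> B r" by fact
    also have "B r = (B r * exp (real r / 32)) * exp (- real r / 32)"
      by (simp add: mult.assoc flip: exp_add)
    also have "\<dots> \<le> K * exp (- real r / 32)"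
      using K[of r] by (intro mult_right_mono) auto
    finally show ?thesis .
  qed
  then show ?thesis using that by blast
qed

section \<open>Families of fair signs on a probability space\<close>

text \<open>Independence is stated through the probabilities of finite cylinders, in a form that is evidently
  preserved when the signs are permuted or some of them are negated.\<close>
definition fair_signs :: "'a measure \<Rightarrow> ('i \<Rightarrow> 'a \<Rightarrow> int) \<Rightarrow> bool" where
  "fair_signs M X \<longleftrightarrow> prob_space M \<and> (\<forall>i. X i \<in> measurable M (count_space UNIV)) \<and>
    (\<forall>i. \<forall>\<omega>\<in>space M. X i \<omega> \<in> {-1, 1}) \<and>
    (\<forall>J s. finite J \<longrightarrow> (\<forall>j\<in>J. s j \<in> {-1, 1}) \<longrightarrow>
      measure M {\<omega> \<in> space M. \<forall>j\<in>J. X j \<omega> = s j} = (1 / 2) ^ card J)"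

lemma fair_signs_finite_coins:
  assumes X: "fair_signs M X" and J: "finite J"
  shows "{\<omega> \<in> space M. Q (\<lambda>i. if i \<in> J then X i \<omega> else 1)} \<in> sets M" (is "?A \<in> _")
    and "measure M {\<omega> \<in> space M. Q (\<lambda>i. if i \<in> J then X i \<omega> else 1)} = coin_prob J Q"
proof -
  interpret prob_space M using X by (simp add: fair_signs_def)
  have [measurable]: "X i \<in> measurable M (count_space UNIV)" for i using X by (simp add: fair_signs_def)
  define cyl where "cyl g = {\<omega> \<in> space M. \<forall>j\<in>J. X j \<omega> = g j}" for g
  have cyl: "cyl g \<in> sets M" for g
    unfolding cyl_def using J by measurable
  have eq: "?A = (\<Union>g\<in>{g \<in> configs J. Q g}. cyl g)"
  proof (intro equalityI subsetI)
    fix \<omega> assume \<omega>: "\<omega> \<in> ?A"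
    let ?g = "\<lambda>i. if i \<in> J then X i \<omega> else 1"
    have "?g \<in> configs J" using X \<omega> by (auto simp: configs_def PiE_dflt_def fair_signs_def)
    moreover have "\<omega> \<in> cyl ?g" using \<omega> by (auto simp: cyl_def)
    ultimately show "\<omega> \<in> (\<Union>g\<in>{g \<in> configs J. Q g}. cyl g)" using \<omega> by blast
  next
    fix \<omega> assume "\<omega> \<in> (\<Union>g\<in>{g \<in> configs J. Q g}. cyl g)"
    then obtain g where g: "g \<in> configs J" "Q g" "\<omega> \<in> cyl g" by blast
    then have "(\<lambda>i. if i \<in> J then X i \<omega> else 1) = g"
      by (auto simp: configs_def PiE_dflt_def cyl_def)
    then show "\<omega> \<in> ?A" using g by (auto simp: cyl_def)
  qed
  have fin: "finite {g \<in> configs J. Q g}" using finite_configs[OF J] by simp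
  then show "?A \<in> sets M" unfolding eq using cyl by blast
  have "disjoint_family_on cyl {g \<in> configs J. Q g}"
    unfolding disjoint_family_on_def
  proof (intro ballI impI)
    fix g h assume gh: "g \<in> {g \<in> configs J. Q g}" "h \<in> {g \<in> configs J. Q g}" "g \<noteq> h"
    then obtain i where "g i \<noteq> h i" by blast
    then have "i \<in> J" using gh by (auto simp: configs_def PiE_dflt_def)
    with \<open>g i \<noteq> h i\<close> show "cyl g \<inter> cyl h = {}" by (auto simp: cyl_def)
  qed
  then have "prob ?A = (\<Sum>g\<in>{g \<in> configs J. Q g}. prob (cyl g))"
    unfolding eq using cyl fin by (intro finite_measure_finite_Union) auto
  also have "\<dots> = (\<Sum>g\<in>{g \<in> configs J. Q g}. (1 / 2) ^ card J)"
  proof (intro sum.cong refl)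
    fix g assume "g \<in> {g \<in> configs J. Q g}"
    then have g: "g \<in> configs J" by simp
    have "\<forall>j\<in>J. g j \<in> {-1, 1}" by (intro ballI configs_sign[OF g])
    then show "prob (cyl g) = (1 / 2) ^ card J"
      using X J unfolding fair_signs_def cyl_def by blast
  qed
  finally show "prob ?A = coin_prob J Q" by (simp add: coin_prob_def power_one_over)
qed

lemma fair_signs_transform:
  fixes h :: "'j \<Rightarrow> 'i" and e :: "'j \<Rightarrow> int"
  assumes X: "fair_signs M X" and h: "inj h" and e: "\<And>i. e i \<in> {-1, 1}"
  shows "fair_signs M (\<lambda>i \<omega>. e i * X (h i) \<omega>)"
  unfolding fair_signs_def
proof (intro conjI allI impI ballI)
  show "prob_space M" using X by (simp add: fair_signs_def)
  have [measurable]: "X i \<in> measurable M (count_space UNIV)" for i using X by (simp add: fair_signs_def)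
  show "(\<lambda>\<omega>. e i * X (h i) \<omega>) \<in> measurable M (count_space UNIV)" for i by measurable
  show "e i * X (h i) \<omega> \<in> {-1, 1}" if "\<omega> \<in> space M" for i \<omega>
  proof -
    have "X (h i) \<omega> \<in> {-1, 1}" using X that unfolding fair_signs_def by blast
    then show ?thesis using e[of i] by auto
  qed
  fix J :: "'j set" and s :: "'j \<Rightarrow> int"
  assume J: "finite J" and s: "\<forall>j\<in>J. s j \<in> {-1, 1}"
  define s' where "s' k = e (inv h k) * s (inv h k)" for k
  have inv: "inv h (h i) = i" for i using h by simp
  have "e j * a = s j \<longleftrightarrow> a = s' (h j)" if "j \<in> J" for j a
    using e[of j] s that unfolding s'_def inv by auto
  then have "{\<omega> \<in> space M. \<forall>j\<in>J. e j * X (h j) \<omega> = s j} = {\<omega> \<in> space M. \<forall>k\<in>h ` J. X k \<omega> = s' k}"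
    by auto
  also have "measure M \<dots> = (1 / 2) ^ card (h ` J)"
  proof -
    have "e k * s k \<in> {-1, 1}" if "k \<in> J" for k
      using e[of k] bspec[OF s that] by auto
    then have "\<forall>k\<in>h ` J. s' k \<in> {-1, 1}" unfolding s'_def by (auto simp: inv)
    then show ?thesis using X J unfolding fair_signs_def by blast
  qed
  also have "card (h ` J) = card J" by (intro card_image inj_on_subset[OF h]) auto
  finally show "measure M {\<omega> \<in> space M. \<forall>j\<in>J. e j * X (h j) \<omega> = s j} = (1 / 2) ^ card J" .
qed

lemma fair_signs_of_indep:
  fixes U V :: "int \<Rightarrow> 'a \<Rightarrow> int"
  assumes M: "prob_space M" and U: "\<And>y \<omega>. \<omega> \<in> space M \<Longrightarrow> U y \<omega> \<in> {-1, 1}"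
    and V: "\<And>x \<omega>. \<omega> \<in> space M \<Longrightarrow> V x \<omega> \<in> {-1, 1}"
    and ind: "prob_space.indep_vars M (\<lambda>_. count_space UNIV) (case_sum U V) UNIV"
    and pU: "\<And>y s. s \<in> {-1, 1} \<Longrightarrow> measure M {\<omega> \<in> space M. U y \<omega> = s} = 1 / 2"
    and pV: "\<And>x s. s \<in> {-1, 1} \<Longrightarrow> measure M {\<omega> \<in> space M. V x \<omega> = s} = 1 / 2"
  shows "fair_signs M (case_sum U V)"
  unfolding fair_signs_def
proof (intro conjI allI impI ballI)
  interpret prob_space M by (rule M)
  show "prob_space M" by (rule M)
  show "case_sum U V i \<in> measurable M (count_space UNIV)" for i
    using ind unfolding indep_vars_def2 by blast
  show "case_sum U V i \<omega> \<in> {-1, 1}" if "\<omega> \<in> space M" for i \<omega>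
    using U[OF that] V[OF that] by (cases i) auto
  have p: "prob (case_sum U V i -` {s} \<inter> space M) = 1 / 2" if "s \<in> {-1, 1}" for i s
  proof -
    have "case_sum U V i -` {s} \<inter> space M = {\<omega> \<in> space M. case_sum U V i \<omega> = s}" by auto
    then show ?thesis using pU[OF that] pV[OF that] by (cases i) auto
  qed
  fix J :: "(int + int) set" and s :: "int + int \<Rightarrow> int"
  assume J: "finite J" and s: "\<forall>j\<in>J. s j \<in> {-1, 1}"
  show "prob {\<omega> \<in> space M. \<forall>j\<in>J. case_sum U V j \<omega> = s j} = (1 / 2) ^ card J"
  proof (cases "J = {}")
    case True
    then show ?thesis by (simp add: prob_space)
  next
    case False
    have "{\<omega> \<in> space M. \<forall>j\<in>J. case_sum U V j \<omega> = s j} = (\<Inter>j\<in>J. case_sum U V j -` {s j} \<inter> space M)"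
      using False by auto
    also have "prob \<dots> = (\<Prod>j\<in>J. prob (case_sum U V j -` {s j} \<inter> space M))"
      by (rule indep_varsD[OF ind False J]) auto
    also have "\<dots> = (\<Prod>j\<in>J. 1 / 2)" using p s by (intro prod.cong) blast+
    finally show ?thesis by simp
  qed
qed

lemma fair_signs_swap:
  fixes U V :: "int \<Rightarrow> 'a \<Rightarrow> int"
  assumes X: "fair_signs M (case_sum U V)"
  shows "fair_signs M (case_sum V U)"
proof -
  have "(\<lambda>i \<omega>. 1 * case_sum U V (case_sum Inr Inl i) \<omega>) = case_sum V U"
    by (auto simp: fun_eq_iff split: sum.split)
  moreover have "inj (case_sum Inr Inl :: int + int \<Rightarrow> _)" by (auto simp: inj_def split: sum.splits)
  ultimately show ?thesis
    using fair_signs_transform[OF X, of "case_sum Inr Inl" "\<lambda>_. 1"] by (simp only:) simp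
qed

lemma fair_signs_reflect:
  fixes U V :: "int \<Rightarrow> 'a \<Rightarrow> int"
  assumes X: "fair_signs M (case_sum U V)"
  shows "fair_signs M (case_sum (\<lambda>y \<omega>. - U y \<omega>) (\<lambda>x \<omega>. V (- x) \<omega>))"
proof -
  let ?h = "map_sum id uminus :: int + int \<Rightarrow> _" and ?e = "case_sum (\<lambda>_. -1) (\<lambda>_. 1) :: int + int \<Rightarrow> int"
  have "(\<lambda>i \<omega>. ?e i * case_sum U V (?h i) \<omega>) = case_sum (\<lambda>y \<omega>. - U y \<omega>) (\<lambda>x \<omega>. V (- x) \<omega>)"
    by (auto simp: fun_eq_iff split: sum.split)
  moreover have "inj ?h" by (intro sum.inj_map) (auto simp: inj_def)
  moreover have "?e i \<in> {-1, 1}" for i by (cases i) auto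
  ultimately show ?thesis using fair_signs_transform[OF X, of ?h ?e] by simp
qed

lemma fair_signs_exits_right:
  assumes X: "fair_signs M (case_sum U V)" and r: "1 \<le> r" and m: "m = int (r ^ 4) + 1"
  shows "{\<omega> \<in> space M. exits_right m (\<lambda>y. U y \<omega>) (\<lambda>x. V x \<omega>)} \<in> sets M"
    and "measure M {\<omega> \<in> space M. exits_right m (\<lambda>y. U y \<omega>) (\<lambda>x. V x \<omega>)} \<le> exit_bound r"
proof -
  let ?Q = "\<lambda>f. exits_right m (\<lambda>y. f (Inl y)) (\<lambda>x. f (Inr x))"
  have eq: "exits_right m (\<lambda>y. U y \<omega>) (\<lambda>x. V x \<omega>) =
      ?Q (\<lambda>i. if i \<in> box_coins m then case_sum U V i \<omega> else 1)" for \<omega>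
    by (rule exits_right_cong) (simp_all add: mem_box_coins)
  have eq: "{\<omega> \<in> space M. exits_right m (\<lambda>y. U y \<omega>) (\<lambda>x. V x \<omega>)} =
      {\<omega> \<in> space M. ?Q (\<lambda>i. if i \<in> box_coins m then case_sum U V i \<omega> else 1)}"
    by (intro Collect_cong conj_cong refl eq)
  show "{\<omega> \<in> space M. exits_right m (\<lambda>y. U y \<omega>) (\<lambda>x. V x \<omega>)} \<in> sets M"
    unfolding eq by (rule fair_signs_finite_coins(1)[OF X finite_box_coins])
  have "measure M {\<omega> \<in> space M. ?Q (\<lambda>i. if i \<in> box_coins m then case_sum U V i \<omega> else 1)} = coin_prob (box_coins m) ?Q"
    by (rule fair_signs_finite_coins(2)[OF X finite_box_coins])
  then show "measure M {\<omega> \<in> space M. exits_right m (\<lambda>y. U y \<omega>) (\<lambda>x. V x \<omega>)} \<le> exit_bound r"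
    using coin_prob_exits_right[OF r m] unfolding eq by (simp only:)
qed

section \<open>The two tail bounds\<close>

lemma less_max_norm_iff: "ereal a < max_norm u v \<longleftrightarrow> (\<exists>i. a < eucl_norm (walk u v i))"
  by (simp add: max_norm_def less_SUP_iff)

lemma eucl_norm_le: "eucl_norm z \<le> \<bar>real_of_int (fst z)\<bar> + \<bar>real_of_int (snd z)\<bar>"
  using norm_Pair_le[of "real_of_int (fst z)" "real_of_int (snd z)"] by (simp add: eucl_norm_def)

lemma eucl_norm_ge: "\<bar>real_of_int (snd z)\<bar> \<le> eucl_norm z"
  using norm_snd_le[where x = "real_of_int (fst z)" and y = "real_of_int (snd z)"] by (simp add: eucl_norm_def)

lemma measure_large_le:
  assumes X: "fair_signs M (case_sum U V)" and r: "1 \<le> r" and n: "4 * r ^ 4 \<le> n"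
  shows "measure M {\<omega> \<in> space M. max_norm (\<lambda>y. U y \<omega>) (\<lambda>x. V x \<omega>) > ereal (real n)} \<le> 4 * exit_bound r"
proof -
  interpret prob_space M using X by (simp add: fair_signs_def)
  define m where "m = int (r ^ 4) + 1"
  define ev where "ev U V = {\<omega> \<in> space M. exits_right m (\<lambda>y. U y \<omega>) (\<lambda>x. V x \<omega>)}" for U V :: "int \<Rightarrow> 'a \<Rightarrow> int"
  have ev: "ev U V \<in> sets M" "measure M (ev U V) \<le> exit_bound r" if "fair_signs M (case_sum U V)" for U V
    using fair_signs_exits_right[OF that r m_def] by (simp_all add: ev_def)
  let ?A = "ev U V" and ?B = "ev (\<lambda>y \<omega>. - U y \<omega>) (\<lambda>x \<omega>. V (- x) \<omega>)"
    and ?C = "ev V U" and ?D = "ev (\<lambda>x \<omega>. - V x \<omega>) (\<lambda>y \<omega>. U (- y) \<omega>)"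
  define q where "q = r ^ 4"
  have "1 \<le> q" "4 * q \<le> n" using r n by (simp_all add: q_def)
  then have n2: "2 * m \<le> int n" unfolding m_def q_def[symmetric] by presburger
  have sub: "{\<omega> \<in> space M. max_norm (\<lambda>y. U y \<omega>) (\<lambda>x. V x \<omega>) > ereal (real n)} \<subseteq> ((?A \<union> ?B) \<union> ?C) \<union> ?D"
  proof
    fix \<omega> assume "\<omega> \<in> {\<omega> \<in> space M. max_norm (\<lambda>y. U y \<omega>) (\<lambda>x. V x \<omega>) > ereal (real n)}"
    then obtain i where \<omega>: "\<omega> \<in> space M" and i: "real n < eucl_norm (walk (\<lambda>y. U y \<omega>) (\<lambda>x. V x \<omega>) i)"
      by (auto simp: less_max_norm_iff)
    have sgn: "U y \<omega> = -1 \<or> U y \<omega> = 1" "V y \<omega> = -1 \<or> V y \<omega> = 1" for y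
    proof -
      have "case_sum U V i \<omega> \<in> {-1, 1}" for i using X \<omega> unfolding fair_signs_def by blast
      from this[of "Inl y"] this[of "Inr y"] show "U y \<omega> = -1 \<or> U y \<omega> = 1" "V y \<omega> = -1 \<or> V y \<omega> = 1" by auto
    qed
    let ?z = "walk (\<lambda>y. U y \<omega>) (\<lambda>x. V x \<omega>) i"
    have "real n < real_of_int (\<bar>fst ?z\<bar> + \<bar>snd ?z\<bar>)" using i eucl_norm_le[of ?z] by simp
    then have "2 * m \<le> \<bar>fst ?z\<bar> + \<bar>snd ?z\<bar>" using n2 by linarith
    then have "m \<le> \<bar>fst ?z\<bar> \<or> m \<le> \<bar>snd ?z\<bar>" by linarith
    moreover have "m > 0" by (simp add: m_def)
    ultimately show "\<omega> \<in> ((?A \<union> ?B) \<union> ?C) \<union> ?D"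
      using exits_some_side[of "\<lambda>y. U y \<omega>" "\<lambda>x. V x \<omega>" m i] sgn \<omega> by (auto simp: ev_def)
  qed
  note fair = X fair_signs_reflect[OF X] fair_signs_swap[OF X] fair_signs_reflect[OF fair_signs_swap[OF X]]
  have "prob {\<omega> \<in> space M. max_norm (\<lambda>y. U y \<omega>) (\<lambda>x. V x \<omega>) > ereal (real n)} \<le> prob (((?A \<union> ?B) \<union> ?C) \<union> ?D)"
    using sub ev(1) fair by (intro finite_measure_mono) auto
  also have "\<dots> \<le> ((prob ?A + prob ?B) + prob ?C) + prob ?D"
  proof -
    have sets: "?A \<in> sets M" "?B \<in> sets M" "?C \<in> sets M" "?D \<in> sets M" by (intro ev(1) fair)+
    show ?thesis
      using measure_Un_le[of "(?A \<union> ?B) \<union> ?C" M ?D] measure_Un_le[of "?A \<union> ?B" M ?C]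
        measure_Un_le[of ?A M ?B] sets sets.Un[OF sets(1,2)] sets.Un[OF sets.Un[OF sets(1,2)] sets(3)]
      by linarith
  qed
  also have "\<dots> \<le> ((exit_bound r + exit_bound r) + exit_bound r) + exit_bound r"
    by (intro add_mono ev(2) fair)
  finally show ?thesis by simp
qed

text \<open>While it stays in columns of sign \<open>1\<close>, the walk meets a new row at every step, so its abscissa is
  a partial sum of row signs.\<close>
lemma straight_up:
  assumes "\<And>x. \<bar>x\<bar> \<le> int L \<Longrightarrow> v x = 1" "\<And>k. k \<le> n \<Longrightarrow> \<bar>\<Sum>i<k. u (int i)\<bar> \<le> int L" "k \<le> Suc n"
  shows "walk u v k = (\<Sum>i<k. u (int i), int k)"
  using assms(3)
proof (induction k)
  case (Suc k)
  then show ?case using assms(1)[of "\<Sum>i<k. u (int i)"] assms(2)[of k] by simp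
qed simp

text \<open>The event bounded from below is that the columns in \<open>[-L, L]\<close> have sign \<open>1\<close> and
  the walk climbs for \<open>n + 1\<close> steps within them.\<close>
lemma measure_large_ge:
  assumes X: "fair_signs M (case_sum U V)" and L: "1 \<le> L"
  shows "(1 / 2) ^ (2 * L + 1) * exp (- 4 * real n / (real L)\<^sup>2) \<le>
    measure M {\<omega> \<in> space M. max_norm (\<lambda>y. U y \<omega>) (\<lambda>x. V x \<omega>) > ereal (real n)}" (is "_ \<le> measure M ?E")
proof -
  interpret prob_space M using X by (simp add: fair_signs_def)
  define J where "J = Inl ` int ` {..<n} \<union> Inr ` {- int L..int L}"
  have J: "finite J" by (simp add: J_def)
  define col where "col f \<longleftrightarrow> (\<forall>i\<in>Inr ` {- int L..int L}. f (i :: int + int) = (1 :: int))" for f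
  define Q where "Q f \<longleftrightarrow> col f \<and> (\<forall>k\<le>n. \<bar>0 + (\<Sum>i<k. f (Inl (int i)))\<bar> \<le> int L)" for f
  have "coin_prob J col = (1 / 2) ^ card (Inr ` {- int L..int L} :: (int + int) set)"
    unfolding col_def by (rule coin_prob_all_one[OF J]) (auto simp: J_def)
  also have "card (Inr ` {- int L..int L} :: (int + int) set) = 2 * L + 1"
    by (subst card_image) auto
  finally have col: "coin_prob J col = (1 / 2) ^ (2 * L + 1)" .
  have "coin_prob J Q = coin_prob J col * stay_prob L n 0"
    unfolding Q_def
    by (rule coin_prob_confined[OF J]) (auto simp: J_def inj_def col_def flip_apply)
  then have "(1 / 2) ^ (2 * L + 1) * exp (- 4 * real n / (real L)\<^sup>2) \<le> coin_prob J Q"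
    using stay_prob_lower[OF L, of n] by (simp add: col)
  also have "\<dots> = prob {\<omega> \<in> space M. Q (\<lambda>i. if i \<in> J then case_sum U V i \<omega> else 1)}"
    by (rule fair_signs_finite_coins(2)[OF X J, symmetric])
  also have "\<dots> \<le> prob ?E"
  proof (rule finite_measure_mono)
    show "{\<omega> \<in> space M. Q (\<lambda>i. if i \<in> J then case_sum U V i \<omega> else 1)} \<subseteq> ?E"
    proof safe
      fix \<omega> assume "\<omega> \<in> space M" and q: "Q (\<lambda>i. if i \<in> J then case_sum U V i \<omega> else 1)"
      have v: "V x \<omega> = 1" if "\<bar>x\<bar> \<le> int L" for x
      proof -
        have "x \<in> {- int L..int L}" using that by auto
        then show ?thesis using q by (force simp: Q_def col_def J_def)
      qed
      have "\<bar>\<Sum>i<k. U (int i) \<omega>\<bar> \<le> int L" if "k \<le> n" for k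
      proof -
        have "(\<Sum>i<k. U (int i) \<omega>) = (\<Sum>i<k. (if Inl (int i) \<in> J then case_sum U V (Inl (int i)) \<omega> else 1))"
          using that by (intro sum.cong) (auto simp: J_def)
        then show ?thesis using q that by (simp add: Q_def)
      qed
      from straight_up[of L "\<lambda>x. V x \<omega>" n "\<lambda>y. U y \<omega>" "Suc n", OF v this]
      have "snd (walk (\<lambda>y. U y \<omega>) (\<lambda>x. V x \<omega>) (Suc n)) = int (Suc n)" by simp
      then have "real n < eucl_norm (walk (\<lambda>y. U y \<omega>) (\<lambda>x. V x \<omega>) (Suc n))"
        using eucl_norm_ge[of "walk (\<lambda>y. U y \<omega>) (\<lambda>x. V x \<omega>) (Suc n)"] by simp
      then show "ereal (real n) < max_norm (\<lambda>y. U y \<omega>) (\<lambda>x. V x \<omega>)" by (simp only: less_max_norm_iff) blast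
    qed
    have meas: "case_sum U V i \<in> measurable M (count_space UNIV)" for i
      using X unfolding fair_signs_def by blast
    have [measurable]: "U y \<in> measurable M (count_space UNIV)" "V y \<in> measurable M (count_space UNIV)" for y
      using meas[of "Inl y"] meas[of "Inr y"] by simp_all
    have [measurable]: "(\<lambda>\<omega>. walk (\<lambda>y. U y \<omega>) (\<lambda>x. V x \<omega>) i) \<in> measurable M (count_space UNIV)" for i
    proof (induction i)
      case (Suc i)
      have "(\<lambda>\<omega>. (\<lambda>z \<omega>. z + (U (snd z) \<omega>, V (fst z) \<omega>)) (walk (\<lambda>y. U y \<omega>) (\<lambda>x. V x \<omega>) i) \<omega>)
          \<in> measurable M (count_space UNIV)"
        by (rule measurable_compose_countable[OF _ Suc]) measurable
      then show ?case by simp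
    qed simp
    show "?E \<in> sets M"
      unfolding less_max_norm_iff by measurable
  qed
  finally show ?thesis .
qed

theorem theorem4:
  fixes M :: "'a measure" and U V :: "int \<Rightarrow> 'a \<Rightarrow> int"
  assumes "prob_space M"
    and "\<And>y \<omega>. \<omega> \<in> space M \<Longrightarrow> U y \<omega> \<in> {-1, 1}"
    and "\<And>x \<omega>. \<omega> \<in> space M \<Longrightarrow> V x \<omega> \<in> {-1, 1}"
    and "prob_space.indep_vars M (\<lambda>_. count_space UNIV) (case_sum U V) (UNIV :: (int + int) set)"
    and "\<And>y s. s \<in> {-1, 1} \<Longrightarrow> measure M {\<omega> \<in> space M. U y \<omega> = s} = 1 / 2"
    and "\<And>x s. s \<in> {-1, 1} \<Longrightarrow> measure M {\<omega> \<in> space M. V x \<omega> = s} = 1 / 2"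
  shows "\<exists>c\<^sub>1 C\<^sub>1 c\<^sub>2 C\<^sub>2 :: real. c\<^sub>1 > 0 \<and> C\<^sub>1 > 0 \<and> c\<^sub>2 > 0 \<and> C\<^sub>2 > 0 \<and>
    (\<forall>n :: nat.
      C\<^sub>1 * exp (- c\<^sub>1 * real n powr (1 / 3))
        \<le> measure M {\<omega> \<in> space M. max_norm (\<lambda>y. U y \<omega>) (\<lambda>x. V x \<omega>) > ereal (real n)} \<and>
      measure M {\<omega> \<in> space M. max_norm (\<lambda>y. U y \<omega>) (\<lambda>x. V x \<omega>) > ereal (real n)}
        \<le> C\<^sub>2 * exp (- c\<^sub>2 * real n powr (1 / 4)))"
proof -
  interpret prob_space M by (rule assms(1))
  have X: "fair_signs M (case_sum U V)" by (rule fair_signs_of_indep[OF assms])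
  define p where "p n = prob {\<omega> \<in> space M. max_norm (\<lambda>y. U y \<omega>) (\<lambda>x. V x \<omega>) > ereal (real n)}" for n
  have lower: "exp (-5) * exp (- 6 * real n powr (1 / 3)) \<le> p n" for n
  proof -
    define a where "a = real n powr (1 / 3)"
    \<comment> \<open>The cube root of \<open>n\<close> is rounded up, and one is added so that \<open>L\<close> is positive for \<open>n = 0\<close>.\<close>
    define L where "L = nat \<lceil>a\<rceil> + 1"
    have a0: "0 \<le> a" by (simp add: a_def)
    have a3: "a ^ 3 = real n"
      unfolding a_def by (cases "n = 0") (auto simp: powr_power)
    have L1: "a \<le> real L" "real L \<le> a + 2" "1 \<le> L" unfolding L_def using a0 by linarith+
    have "exp (-5) * exp (- 6 * a) \<le> exp (- real (2 * L + 1)) * exp (- 4 * real n / (real L)\<^sup>2)"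
    proof -
      have "real n / (real L)\<^sup>2 \<le> a"
      proof -
        have "a\<^sup>2 \<le> (real L)\<^sup>2" using L1 a0 by (intro power_mono)
        then have "a * a\<^sup>2 \<le> a * (real L)\<^sup>2" using a0 by (intro mult_left_mono)
        moreover have "a * a\<^sup>2 = real n" using a3 by (simp add: power2_eq_square power3_eq_cube)
        ultimately show ?thesis using L1(3) by (simp add: divide_le_eq)
      qed
      then have "-5 + - 6 * a \<le> - real (2 * L + 1) + - 4 * real n / (real L)\<^sup>2"
        using L1(2) by simp
      then show ?thesis by (simp only: exp_add[symmetric] exp_le_cancel_iff)
    qed
    also have "\<dots> \<le> (1 / 2) ^ (2 * L + 1) * exp (- 4 * real n / (real L)\<^sup>2)"
    proof (rule mult_right_mono)
      have "exp (- 1) \<le> (1 / 2 :: real)"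
        using exp_ge_add_one_self[of 1] by (simp add: exp_minus field_simps)
      then have "exp (- 1) ^ (2 * L + 1) \<le> (1 / 2 :: real) ^ (2 * L + 1)" by (intro power_mono) auto
      moreover have "exp (- 1) ^ (2 * L + 1) = exp (- real (2 * L + 1))"
        by (simp only: exp_of_nat_mult[symmetric]) simp
      ultimately show "exp (- real (2 * L + 1)) \<le> (1 / 2) ^ (2 * L + 1)" by simp
    qed simp
    also have "\<dots> \<le> p n" unfolding p_def by (rule measure_large_ge[OF X L1(3)])
    finally show ?thesis by (simp add: a_def)
  qed
  obtain K where K: "\<And>r. exit_bound r \<le> K * exp (- real r / 32)" using exit_bound_exponential by blast
  \<comment> \<open>The maximum with \<open>1\<close> covers the values of \<open>n\<close> for which \<open>r\<close> below is zero.\<close>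
  define C where "C = max (4 * K) 1"
  define c where "c = (1 / 4) powr (1 / 4) / (32 :: real)"
  have upper: "p n \<le> C * exp (1 / 32) * exp (- c * real n powr (1 / 4))" for n
  proof -
    define b where "b = (real n / 4) powr (1 / 4)"
    define r where "r = nat \<lfloor>b\<rfloor>"
    have b0: "0 \<le> b" by (simp add: b_def)
    have b4: "b ^ 4 = real n / 4" unfolding b_def by (cases "n = 0") (auto simp: powr_power)
    have r: "real r \<le> b" "b \<le> real r + 1" unfolding r_def using b0 by linarith+
    have "real r ^ 4 \<le> real n / 4" unfolding b4[symmetric] using r by (intro power_mono) auto
    then have "real (4 * r ^ 4) \<le> real n" by simp
    then have n: "4 * r ^ 4 \<le> n" by (simp only: of_nat_le_iff)
    have "p n \<le> C * exp (- real r / 32)"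
    proof (cases "r = 0")
      case True
      then show ?thesis by (simp add: C_def p_def le_max_iff_disj)
    next
      case False
      then have "p n \<le> 4 * exit_bound r"
        unfolding p_def using measure_large_le[OF X _ n] by simp
      also have "\<dots> \<le> (4 * K) * exp (- real r / 32)" using K[of r] by simp
      also have "\<dots> \<le> C * exp (- real r / 32)" by (intro mult_right_mono) (auto simp: C_def)
      finally show ?thesis .
    qed
    also have "\<dots> \<le> C * (exp (1 / 32) * exp (- b / 32))"
      unfolding exp_add[symmetric] using r(2) by (intro mult_left_mono) (auto simp: C_def)
    also have "- b / 32 = - c * real n powr (1 / 4)"
      unfolding b_def c_def using powr_mult[of "1 / 4" "real n" "1 / 4"] by simp
    finally show ?thesis by (simp add: mult.assoc)
  qed
  have pos: "exp (-5) > (0 :: real)" "c > 0" "C * exp (1 / 32) > 0" "(6 :: real) > 0"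
    by (auto simp: c_def C_def)
  show ?thesis
    using lower upper pos unfolding p_def by blast
qed

end
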